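(* Let $(X,d)$ be an infinite metric space and let $\mathfrak{B}$ be a bornology on $X$ with a closed base such that $X\notin\mathfrak{B}$. The following statements are equivalent. (1) $(C(X),\tau^s_{\mathfrak{B}})$ is a k-space. (2) $(C(X),\tau^s_{\mathfrak{B}})$ is Fréchet–Urysohn. (3) $X$ satisfies $\mathsf{S}_1(\mathcal{O}_{\mathfrak{B}^s},\Gamma_{\mathfrak{B}^s})$.
   Context: A bornology on a set $X$ is a family $\mathfrak{B}$ of subsets of $X$ that covers $X$, is closed under finite unions and is closed under taking subsets. A base of $\mathfrak{B}$ is a subfamily $\mathfrak{B}_0\subseteq\mathfrak{B}$ such that every $B\in\mathfrak{B}$ is contained in some $B_0\in\mathfrak{B}_0$; it is a closed base if all its members are closed in $X$. For $B\subseteq X$ and $\delta>0$, $B^\delta=\bigcup_{x\in B}\{y\in X: d(x,y)<\delta\}$. $C(X)$ is the set of continuous functions $X\to\mathbb{R}$. The topology $\tau^s_{\mathfrak{B}}$ of strong uniform convergence on $\mathfrak{B}$ is the topology on $C(X)$ induced by the uniformity with base consisting of the sets $[B,\varepsilon]^s=\{(f,g): \exists\delta>0\ \forall x\in B^\delta,\ |f(x)-g(x)|<\varepsilon\}$, $B\in\mathfrak{B}$, $\varepsilon>0$. An open $\mathfrak{B}^s$-cover of $X$ is a family $\mathcal{U}$ of open subsets of $X$ that covers $X$ with $X\notin\mathcal{U}$ such that for every $B\in\mathfrak{B}$ there are $U\in\mathcal{U}$ and $\delta>0$ with $B^\delta\subseteq U$; $\mathcal{O}_{\mathfrak{B}^s}$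 is the collection of all of them. A $\gamma_{\mathfrak{B}^s}$-cover of $X$ is an open cover $\{U_n:n\in\mathbb{N}\}$, infinite and not containing $X$ as a member, such that for every $B\in\mathfrak{B}$ there are $n_0\in\mathbb{N}$ and positive reals $\delta_n$ ($n\ge n_0$) with $B^{\delta_n}\subseteq U_n$ for all $n\ge n_0$; $\Gamma_{\mathfrak{B}^s}$ is the collection of all of them. $\mathsf{S}_1(\mathcal{A},\mathcal{C})$ means: for every sequence $(A_n)_{n\in\mathbb{N}}$ of elements of $\mathcal{A}$ one can choose $a_n\in A_n$ for each $n$ such that $\{a_n:n\in\mathbb{N}\}\in\mathcal{C}$. A space $Y$ is a k-space if a subset $A\subseteq Y$ is closed exactly when $A\cap K$ is closed in $K$ for every compact $K\subseteq Y$. $Y$ is Fréchet–Urysohn if for each $A\subseteq Y$ and $y\in\overline{A}$ there is a sequence in $A$ converging to $y$. *)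

theory Defs
  imports "HOL-Analysis.Analysis"
begin

text \<open>The metric space is the whole of a type of class \<^class>\<open>metric_space\<close>,
  so that \<open>X\<close> is \<^term>\<open>UNIV\<close>.\<close>

definition bornology :: "'a set set \<Rightarrow> bool" where
  "bornology \<BB> \<longleftrightarrow>
     \<Union>\<BB> = UNIV \<and>
     (\<forall>\<F>. finite \<F> \<and> \<F> \<subseteq> \<BB> \<longrightarrow> \<Union>\<F> \<in> \<BB>) \<and>
     (\<forall>B\<in>\<BB>. \<forall>A. A \<subseteq> B \<longrightarrow> A \<in> \<BB>)"

definition bornology_base :: "'a set set \<Rightarrow> 'a set set \<Rightarrow> bool" where
  "bornology_base \<BB> \<BB>\<^sub>0 \<longleftrightarrow> \<BB>\<^sub>0 \<subseteq> \<BB> \<and> (\<forall>B\<in>\<BB>. \<exists>B\<^sub>0\<in>\<BB>\<^sub>0. B \<subseteq> B\<^sub>0)"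

definition has_closed_base :: "'a::topological_space set set \<Rightarrow> bool" where
  "has_closed_base \<BB> \<longleftrightarrow> (\<exists>\<BB>\<^sub>0. bornology_base \<BB> \<BB>\<^sub>0 \<and> (\<forall>B\<in>\<BB>\<^sub>0. closed B))"

definition enlargement :: "'a::metric_space set \<Rightarrow> real \<Rightarrow> 'a set" where
  "enlargement B \<delta> = (\<Union>x\<in>B. ball x \<delta>)"

definition continuous_functions :: "('a::topological_space \<Rightarrow> real) set" where
  "continuous_functions = {f. continuous_on UNIV f}"

definition strong_entourage ::
  "'a::metric_space set \<Rightarrow> real \<Rightarrow> (('a \<Rightarrow> real) \<times> ('a \<Rightarrow> real)) set" where
  "strong_entourage B \<epsilon> =
     {(f, g). f \<in> continuous_functions \<and> g \<in> continuous_functions \<and>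
        (\<exists>\<delta>>0. \<forall>x\<in>enlargement B \<delta>. \<bar>f x - g x\<bar> < \<epsilon>)}"

definition strong_uniformity_base ::
  "'a::metric_space set set \<Rightarrow> (('a \<Rightarrow> real) \<times> ('a \<Rightarrow> real)) set set" where
  "strong_uniformity_base \<BB> = {strong_entourage B \<epsilon> | B \<epsilon>. B \<in> \<BB> \<and> \<epsilon> > 0}"

text \<open>The topology on \<open>S\<close> induced by the uniformity with base \<open>\<E>\<close>. It suffices to quantify
  over the base, since every entourage of the uniformity contains a member of the base.\<close>

definition topology_of_uniformity_base :: "'b set \<Rightarrow> ('b \<times> 'b) set set \<Rightarrow> 'b topology" where
  "topology_of_uniformity_base S \<E> =
     topology (\<lambda>W. W \<subseteq> S \<and> (\<forall>f\<in>W. \<exists>E\<in>\<E>. E `` {f} \<subseteq> W))"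

definition strong_uniform_topology ::
  "'a::metric_space set set \<Rightarrow> ('a \<Rightarrow> real) topology" where
  "strong_uniform_topology \<BB> =
     topology_of_uniformity_base continuous_functions (strong_uniformity_base \<BB>)"

definition open_strong_cover :: "'a::metric_space set set \<Rightarrow> 'a set set \<Rightarrow> bool" where
  "open_strong_cover \<BB> \<U> \<longleftrightarrow>
     (\<forall>U\<in>\<U>. open U) \<and> \<Union>\<U> = UNIV \<and> UNIV \<notin> \<U> \<and>
     (\<forall>B\<in>\<BB>. \<exists>U\<in>\<U>. \<exists>\<delta>>0. enlargement B \<delta> \<subseteq> U)"

text \<open>Being a gamma cover is a property of the family; some enumeration witnesses it.
  An enumeration may repeat members, and the choice of enumeration does not matter: no member
  can occur infinitely often in a witnessing enumeration, as it would contain every member of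
  the bornology and hence be the whole space.\<close>

definition strong_gamma_cover :: "'a::metric_space set set \<Rightarrow> 'a set set \<Rightarrow> bool" where
  "strong_gamma_cover \<BB> \<U> \<longleftrightarrow>
     (\<forall>U\<in>\<U>. open U) \<and> \<Union>\<U> = UNIV \<and> infinite \<U> \<and> UNIV \<notin> \<U> \<and>
     (\<exists>U :: nat \<Rightarrow> 'a set. \<U> = range U \<and>
        (\<forall>B\<in>\<BB>. \<exists>n\<^sub>0. \<exists>\<delta> :: nat \<Rightarrow> real. \<forall>n\<ge>n\<^sub>0. \<delta> n > 0 \<and> enlargement B (\<delta> n) \<subseteq> U n))"

definition selection_S1 :: "'b set set \<Rightarrow> 'b set set \<Rightarrow> bool" where
  "selection_S1 \<A> \<C> \<longleftrightarrow>
     (\<forall>A :: nat \<Rightarrow> 'b set. (\<forall>n. A n \<in> \<A>) \<longrightarrow>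
        (\<exists>a. (\<forall>n. a n \<in> A n) \<and> range a \<in> \<C>))"

definition frechet_urysohn_space :: "'b topology \<Rightarrow> bool" where
  "frechet_urysohn_space Y \<longleftrightarrow>
     (\<forall>A\<subseteq>topspace Y. \<forall>y\<in>Y closure_of A.
        \<exists>s :: nat \<Rightarrow> 'b. range s \<subseteq> A \<and> limitin Y s y sequentially)"

lemma enlargement_iff: "y \<in> enlargement B \<delta> \<longleftrightarrow> (\<exists>x\<in>B. dist x y < \<delta>)"
  by (auto simp: enlargement_def)

lemma enlargement_mono: "A \<subseteq> B \<Longrightarrow> \<delta> \<le> \<eta> \<Longrightarrow> enlargement A \<delta> \<subseteq> enlargement B \<eta>"
  by (force simp: enlargement_def)

lemma strong_entourage_mono:
  assumes "A \<subseteq> B" "\<epsilon> \<le> \<eta>"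
  shows "strong_entourage B \<epsilon> \<subseteq> strong_entourage A \<eta>"
proof clarify
  fix f g assume "(f, g) \<in> strong_entourage B \<epsilon>"
  then obtain \<delta> where fg: "f \<in> continuous_functions" "g \<in> continuous_functions"
    and \<delta>: "\<delta> > 0" "\<forall>x\<in>enlargement B \<delta>. \<bar>f x - g x\<bar> < \<epsilon>"
    by (auto simp: strong_entourage_def)
  have "\<forall>x\<in>enlargement A \<delta>. \<bar>f x - g x\<bar> < \<eta>"
    using \<delta>(2) enlargement_mono[OF assms(1) order_refl, of \<delta>] assms(2) by force
  then show "(f, g) \<in> strong_entourage A \<eta>"
    using fg \<delta>(1) by (auto simp: strong_entourage_def)
qed

lemma openin_topology_of_uniformity_base:
  assumes "\<E> \<noteq> {}"
    and "\<And>E F. E \<in> \<E> \<Longrightarrow> F \<in> \<E> \<Longrightarrow> \<exists>G\<in>\<E>. G \<subseteq> E \<inter> F"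
  shows "openin (topology_of_uniformity_base S \<E>) W \<longleftrightarrow>
    W \<subseteq> S \<and> (\<forall>f\<in>W. \<exists>E\<in>\<E>. E `` {f} \<subseteq> W)"
proof -
  have "istopology (\<lambda>W. W \<subseteq> S \<and> (\<forall>f\<in>W. \<exists>E\<in>\<E>. E `` {f} \<subseteq> W))"
    unfolding istopology_def
  proof (intro conjI allI impI)
    fix V W
    assume V: "V \<subseteq> S \<and> (\<forall>f\<in>V. \<exists>E\<in>\<E>. E `` {f} \<subseteq> V)"
      and W: "W \<subseteq> S \<and> (\<forall>f\<in>W. \<exists>E\<in>\<E>. E `` {f} \<subseteq> W)"
    show "V \<inter> W \<subseteq> S" using V by blast
    show "\<forall>f\<in>V \<inter> W. \<exists>E\<in>\<E>. E `` {f} \<subseteq> V \<inter> W"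
    proof
      fix f assume "f \<in> V \<inter> W"
      then obtain E F where "E \<in> \<E>" "E `` {f} \<subseteq> V" "F \<in> \<E>" "F `` {f} \<subseteq> W"
        using V W by blast
      moreover obtain G where "G \<in> \<E>" "G \<subseteq> E \<inter> F"
        using assms(2) calculation by blast
      ultimately show "\<exists>E\<in>\<E>. E `` {f} \<subseteq> V \<inter> W" by blast
    qed
  next
    fix \<W>
    assume *: "\<forall>W\<in>\<W>. W \<subseteq> S \<and> (\<forall>f\<in>W. \<exists>E\<in>\<E>. E `` {f} \<subseteq> W)"
    show "\<Union>\<W> \<subseteq> S" using * by blast
    show "\<forall>f\<in>\<Union>\<W>. \<exists>E\<in>\<E>. E `` {f} \<subseteq> \<Union>\<W>"
    proof
      fix f assume "f \<in> \<Union>\<W>"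
      then obtain W where "W \<in> \<W>" "f \<in> W" by blast
      moreover obtain E where "E \<in> \<E>" "E `` {f} \<subseteq> W"
        using * calculation by blast
      ultimately show "\<exists>E\<in>\<E>. E `` {f} \<subseteq> \<Union>\<W>" by blast
    qed
  qed
  then show ?thesis
    by (simp add: topology_of_uniformity_base_def topology_inverse')
qed

lemma openin_strong_uniform_topology:
  assumes "bornology \<BB>"
  shows "openin (strong_uniform_topology \<BB>) W \<longleftrightarrow>
    W \<subseteq> continuous_functions \<and>
    (\<forall>f\<in>W. \<exists>B\<in>\<BB>. \<exists>\<epsilon>>0. strong_entourage B \<epsilon> `` {f} \<subseteq> W)"
proof -
  have "strong_uniformity_base \<BB> \<noteq> {}"
  proof -
    obtain B where "B \<in> \<BB>" using assms by (auto simp: bornology_def)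
    then show ?thesis unfolding strong_uniformity_base_def using zero_less_one by blast
  qed
  moreover have "\<exists>G\<in>strong_uniformity_base \<BB>. G \<subseteq> E \<inter> F"
    if EF: "E \<in> strong_uniformity_base \<BB>" "F \<in> strong_uniformity_base \<BB>" for E F
  proof -
    obtain A \<epsilon> B \<eta> where AB: "A \<in> \<BB>" "B \<in> \<BB>" "\<epsilon> > 0" "\<eta> > 0"
      and E: "E = strong_entourage A \<epsilon>" and F: "F = strong_entourage B \<eta>"
      using EF by (auto simp: strong_uniformity_base_def)
    have "\<forall>\<F>. finite \<F> \<and> \<F> \<subseteq> \<BB> \<longrightarrow> \<Union>\<F> \<in> \<BB>"
      using assms by (simp add: bornology_def)
    from this[rule_format, of "{A, B}"] have "A \<union> B \<in> \<BB>"
      using AB by simp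
    then have "strong_entourage (A \<union> B) (min \<epsilon> \<eta>) \<in> strong_uniformity_base \<BB>"
      unfolding strong_uniformity_base_def using AB(3,4) by force
    moreover have "strong_entourage (A \<union> B) (min \<epsilon> \<eta>) \<subseteq> E \<inter> F"
      unfolding E F by (intro Int_greatest strong_entourage_mono) auto
    ultimately show ?thesis by blast
  qed
  ultimately have "openin (strong_uniform_topology \<BB>) W \<longleftrightarrow> W \<subseteq> continuous_functions \<and>
      (\<forall>f\<in>W. \<exists>E\<in>strong_uniformity_base \<BB>. E `` {f} \<subseteq> W)"
    unfolding strong_uniform_topology_def by (rule openin_topology_of_uniformity_base)
  moreover have "(\<exists>E\<in>strong_uniformity_base \<BB>. E `` {f} \<subseteq> W) \<longleftrightarrow>
      (\<exists>B\<in>\<BB>. \<exists>\<epsilon>>0. strong_entourage B \<epsilon> `` {f} \<subseteq> W)" for f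
    unfolding strong_uniformity_base_def by blast
  ultimately show ?thesis by simp
qed

lemma topspace_strong_uniform_topology:
  assumes "bornology \<BB>"
  shows "topspace (strong_uniform_topology \<BB>) = continuous_functions"
proof (rule subset_antisym)
  show "topspace (strong_uniform_topology \<BB>) \<subseteq> continuous_functions"
    using openin_topspace openin_strong_uniform_topology[OF assms] by blast
  obtain B where B: "B \<in> \<BB>" using assms by (auto simp: bornology_def)
  have "strong_entourage B 1 `` {f} \<subseteq> continuous_functions" for f
    by (auto simp: strong_entourage_def)
  then have "openin (strong_uniform_topology \<BB>) continuous_functions"
    unfolding openin_strong_uniform_topology[OF assms]
    using B zero_less_one by blast
  then show "continuous_functions \<subseteq> topspace (strong_uniform_topology \<BB>)"
    by (rule openin_subset)
qed

end

theory Submission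
  imports Defs "HOL-Library.Countable_Set_Type"
begin

text \<open>From the selection principle to the Frechet-Urysohn property: if \<open>g\<close> is in the closure of
  \<open>A\<close>, then for each \<open>n\<close> the sets \<open>{x. |f x - g x| < 1/(n+1)}\<close>, \<open>f \<in> A\<close>, form a strong cover
  (unless one of them is the whole space), and a selected gamma cover yields a sequence in \<open>A\<close>
  converging to \<open>g\<close>.

  For the converse, a k-space \<open>C(X)\<close> is first shown to be countably tight. If a subset \<open>D\<close> of a
  compact set contains the closures of its countable subsets but misses a point \<open>g\<close> of its closure,
  recursion over the first uncountable ordinal gives functions \<open>f a \<in> D\<close> and finite sets \<open>F a\<close>
  such that \<open>f b\<close> is far from \<open>g\<close> somewhere on \<open>F a\<close> for \<open>b < a\<close>, while \<open>f a\<close> is close to \<open>g\<close>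
  on \<open>F b\<close>. Every \<open>B\<close> in the bornology then has an enlargement containing only finitely many of
  the \<open>F a\<close>, and the functions that are large on almost all \<open>F a\<close> form a set that is closed on
  compact sets but not closed. Tightness reduces a strong cover to a countable one, and
  the k-property, applied to unboundedly scaled bump functions, thins that out to a gamma sequence.
  The cover by complements of points gives in this way points \<open>x n\<close> of which each \<open>B\<close> contains only
  finitely many; the selection principle follows by passing to a gamma sequence in the cover by the
  sets \<open>U\<^sub>0 \<inter> \<dots> \<inter> U\<^sub>n - {x n}\<close> with \<open>U\<^sub>i\<close> in the \<open>i\<close>-th given cover.\<close>

section \<open>Well-orders, choices from infinite sets, and compactness\<close>

text \<open>The order is the strict part of the cardinal successor of \<open>natLeq\<close>, a copy
  of the first uncountable ordinal; \<open>cardSuc\<close> lives on sets of the underlying type,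
  hence \<open>nat set\<close>.\<close>

lemma uncountable_wellorder_countable_segments:
  includes cardinal_syntax
  obtains R :: "(nat set \<times> nat set) set" and I
  where "wf R" "trans R" "total_on I R" "uncountable I" "\<And>a. countable {b. (b, a) \<in> R}"
proof
  define r where "r = cardSuc natLeq"
  have r: "Card_order r" "natLeq <o r"
    unfolding r_def by (simp_all add: cardSuc_Card_order cardSuc_greater natLeq_Card_order)
  then have wo: "Well_order r"
    by (metis card_order_on_well_order_on)
  then show "wf (r - Id)"
    by (simp add: well_order_on_def)
  have lin: "trans r" "antisym r" "total_on (Field r) r"
    using wo by (auto simp: well_order_on_def linear_order_on_def partial_order_on_def preorder_on_def)
  then show "trans (r - Id)"
    by (intro trans_diff_Id)
  show "total_on (Field r) (r - Id)"
    using lin by (simp add: total_on_diff_Id)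
  show "uncountable (Field r)"
  proof
    assume "countable (Field r)"
    then have "|Field r| \<le>o natLeq"
      by (simp add: countable_card_le_natLeq)
    then have "r \<le>o natLeq"
      by (rule ordIso_ordLeq_trans[OF ordIso_symmetric[OF card_of_Field_ordIso[OF r(1)]]])
    with r(2) show False
      by (simp add: not_ordLess_ordLeq)
  qed
  show "countable {b. (b, a) \<in> r - Id}" for a
  proof (cases "a \<in> Field r")
    case True
    then have "|underS r a| <o r"
      using r(1) by (rule card_of_underS[rotated])
    then have "|underS r a| \<le>o natLeq"
      by (simp add: r_def cardSuc_ordLeq_ordLess[OF natLeq_Card_order card_of_Card_order])
    moreover have "{b. (b, a) \<in> r - Id} = underS r a"
      by (auto simp: underS_def)
    ultimately show ?thesis
      by (simp add: countable_card_le_natLeq)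
  next
    case False
    then have "{b. (b, a) \<in> r - Id} = {}"
      by (auto simp: Field_def)
    then show ?thesis by (metis countable_empty)
  qed
qed

text \<open>Each step takes a least element of \<open>S n\<close> outside a finite set of excluded
  ones. The next choice was already a candidate one step earlier, so it is not below, and totality
  puts it above.\<close>

lemma increasing_choice_from_infinite_sets:
  assumes "wf R" "total_on J R" and S: "\<And>n. infinite (S n)" "\<And>n. S (Suc n) \<subseteq> S n" "S 0 \<subseteq> J"
  obtains a :: "nat \<Rightarrow> 'a" where "\<And>n. a n \<in> S n" "\<And>n. (a n, a (Suc n)) \<in> R"
proof -
  define P where "P = (\<lambda>n (p :: 'a \<times> 'a set). finite (snd p) \<and> fst p \<in> S n - snd p \<and>
    (\<forall>c\<in>S n - snd p. (c, fst p) \<notin> R))"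
  define Q where "Q = (\<lambda>(n::nat) (p :: 'a \<times> 'a set) (q :: 'a \<times> 'a set). snd q = insert (fst p) (snd p))"
  have least: "\<exists>x. P n (x, E)" if "finite E" for n E
  proof -
    have "S n - E \<noteq> {}"
      using S(1)[of n] that by (metis Diff_infinite_finite finite.emptyI)
    then show ?thesis
      using \<open>wf R\<close> that unfolding P_def wf_eq_minimal by (metis (no_types, lifting) ex_in_conv fst_conv snd_conv)
  qed
  have "\<exists>p. (\<forall>n. P n (p n)) \<and> (\<forall>n. Q n (p n) (p (Suc n)))"
  proof (unfold all_conj_distrib[symmetric], rule dependent_nat_choice)
    show "\<exists>x. P 0 x" using least[of "{}"] by blast
    show "\<exists>y. P (Suc n) y \<and> Q n x y" if "P n x" for x n
      using least[of "insert (fst x) (snd x)" "Suc n"] that unfolding P_def Q_def by auto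
  qed
  then obtain p where p: "\<And>n. P n (p n)" "\<And>n. Q n (p n) (p (Suc n))"
    by blast
  have sub: "S n \<subseteq> J" for n
    by (induction n) (use S in auto)
  have "(fst (p n), fst (p (Suc n))) \<in> R" for n
  proof -
    have 1: "fst (p (Suc n)) \<in> S (Suc n)" "fst (p (Suc n)) \<notin> insert (fst (p n)) (snd (p n))"
      using p(1)[of "Suc n"] p(2)[of n] by (auto simp: P_def Q_def)
    then have "(fst (p (Suc n)), fst (p n)) \<notin> R"
      using p(1)[of n] S(2)[of n] by (auto simp: P_def)
    moreover have "fst (p n) \<in> J" "fst (p (Suc n)) \<in> J"
      using 1(1) sub p(1)[of n] by (auto simp: P_def)
    ultimately show ?thesis
      using \<open>total_on J R\<close> 1(2) unfolding total_on_def by (metis insertI1)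
  qed
  moreover have "fst (p n) \<in> S n" for n
    using p(1)[of n] by (auto simp: P_def)
  ultimately show ?thesis by (intro that[of "\<lambda>n. fst (p n)"])
qed

text \<open>Otherwise finitely many open sets, each hit for only finitely many indices, would cover
  \<open>K\<close>. Indices are counted, not values, so repetitions are harmless.\<close>

lemma compactin_cluster_point:
  assumes "compactin Y K" "infinite I" "s ` I \<subseteq> K"
  obtains h where "h \<in> K" "\<And>U. openin Y U \<Longrightarrow> h \<in> U \<Longrightarrow> infinite {i\<in>I. s i \<in> U}"
proof (rule ccontr)
  assume "\<not> thesis"
  then have "\<forall>h\<in>K. \<exists>U. openin Y U \<and> h \<in> U \<and> finite {i\<in>I. s i \<in> U}"
    using that by blast
  then obtain U where U: "\<And>h. h \<in> K \<Longrightarrow> openin Y (U h) \<and> h \<in> U h \<and> finite {i\<in>I. s i \<in> U h}"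
    by metis
  then obtain \<F> where \<F>: "finite \<F>" "\<F> \<subseteq> U ` K" "K \<subseteq> \<Union>\<F>"
    using compactinD[OF assms(1), of "U ` K"] by blast
  have "I \<subseteq> (\<Union>V\<in>\<F>. {i\<in>I. s i \<in> V})"
    using \<F>(3) assms(3) by blast
  moreover have "finite (\<Union>V\<in>\<F>. {i\<in>I. s i \<in> V})"
    using \<F>(1,2) U by blast
  ultimately show False
    using assms(2) finite_subset by blast
qed

text \<open>A convergent sequence together with its limit is compact, so a set with closed traces on
  compact sets contains the limits of its sequences.\<close>

lemma frechet_urysohn_imp_k_space:
  assumes "frechet_urysohn_space Y"
  shows "k_space Y"
  unfolding k_space
proof (intro allI impI, elim conjE)
  fix S assume S: "S \<subseteq> topspace Y"
    and K: "\<forall>K. compactin Y K \<longrightarrow> closedin (subtopology Y K) (K \<inter> S)"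
  have "y \<in> S" if y: "y \<in> Y closure_of S" for y
  proof -
    obtain s where s: "range s \<subseteq> S" "limitin Y s y sequentially"
      using assms S y unfolding frechet_urysohn_space_def by blast
    define K where "K = insert y (range s)"
    have "compactin Y K"
      unfolding K_def using compactin_sequence_with_limit[OF s(2)] s(1) S by blast
    then obtain T where T: "closedin Y T" "K \<inter> S = T \<inter> K"
      using K closedin_subtopology by metis
    have "range s \<subseteq> T"
      using T(2) s(1) K_def by blast
    then have "y \<in> T"
      using limitin_closedin[OF s(2) T(1)] by (simp add: range_subsetD)
    then show ?thesis
      using T(2) K_def by blast
  qed
  then show "closedin Y S"
    using S closure_of_subset_eq by blast
qed

section \<open>Strong inclusion and bump functions\<close>

definition strongly_inside :: "'a::metric_space set \<Rightarrow> 'a set \<Rightarrow> bool" where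
  "strongly_inside B U \<longleftrightarrow> (\<exists>\<delta>>0. enlargement B \<delta> \<subseteq> U)"

lemma strongly_inside_mono: "strongly_inside B U \<Longrightarrow> A \<subseteq> B \<Longrightarrow> U \<subseteq> V \<Longrightarrow> strongly_inside A V"
  unfolding strongly_inside_def by (meson enlargement_mono order_refl order_trans)

lemma strongly_inside_Int: "strongly_inside B U \<Longrightarrow> strongly_inside B V \<Longrightarrow> strongly_inside B (U \<inter> V)"
proof -
  assume "strongly_inside B U" "strongly_inside B V"
  then obtain \<delta> \<eta> where "\<delta> > 0" "enlargement B \<delta> \<subseteq> U" "\<eta> > 0" "enlargement B \<eta> \<subseteq> V"
    unfolding strongly_inside_def by blast
  moreover have "enlargement B (min \<delta> \<eta>) \<subseteq> enlargement B \<delta>" "enlargement B (min \<delta> \<eta>) \<subseteq> enlargement B \<eta>"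
    by (simp_all add: enlargement_mono)
  ultimately show ?thesis
    unfolding strongly_inside_def by (intro exI[of _ "min \<delta> \<eta>"]) auto
qed

lemma strongly_inside_UNIV: "strongly_inside B UNIV"
  unfolding strongly_inside_def by (auto intro: exI[of _ 1])

lemma strongly_inside_Inter:
  "finite I \<Longrightarrow> (\<And>i. i \<in> I \<Longrightarrow> strongly_inside B (U i)) \<Longrightarrow> strongly_inside B (\<Inter>i\<in>I. U i)"
  by (induction I rule: finite_induct) (auto simp: strongly_inside_UNIV intro: strongly_inside_Int)

lemma strongly_inside_subset: "strongly_inside B U \<Longrightarrow> B \<subseteq> U"
  unfolding strongly_inside_def enlargement_def by force

lemma strongly_inside_Compl_singleton:
  assumes "closed B" "x \<notin> B"
  shows "strongly_inside B (- {x})"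
proof -
  obtain \<delta> where "\<delta> > 0" "ball x \<delta> \<subseteq> - B"
    using assms open_contains_ball[of "- B"] by auto
  then have "x \<notin> enlargement B \<delta>"
    unfolding enlargement_iff by (auto simp: dist_commute subset_iff)
  with \<open>\<delta> > 0\<close> show ?thesis
    unfolding strongly_inside_def by blast
qed

text \<open>The slope \<open>k\<close> decides how fast the function falls from 1 inside
  \<open>U\<close>. For \<open>U = UNIV\<close> the convention \<open>infdist x {} = 0\<close> makes
  it constantly 1.\<close>

definition bump :: "'a::metric_space set \<Rightarrow> nat \<Rightarrow> 'a \<Rightarrow> real" where
  "bump U k x = max 0 (1 - real k * infdist x (- U))"

lemma continuous_bump: "continuous_on S (bump U k)"
  unfolding bump_def by (intro continuous_intros)

lemma bump_le_1: "bump U k x \<le> 1"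
  unfolding bump_def by (simp_all add: infdist_nonneg)

lemma bump_outside: "x \<notin> U \<Longrightarrow> bump U k x = 1"
  unfolding bump_def by simp

text \<open>Halving the radius keeps the smaller enlargement at least half the radius away from the
  complement of \<open>U\<close>; a slope above the reciprocal of that distance gives zero.\<close>

lemma bump_vanishes_near:
  assumes "strongly_inside B U" "U \<noteq> UNIV"
  obtains k \<delta> where "\<delta> > 0" "\<And>x. x \<in> enlargement B \<delta> \<Longrightarrow> bump U k x = 0"
proof -
  obtain \<delta> where \<delta>: "\<delta> > 0" "enlargement B \<delta> \<subseteq> U"
    using assms(1) unfolding strongly_inside_def by blast
  obtain k :: nat where k: "2 / \<delta> < real k"
    using reals_Archimedean2 by blast
  have "bump U k y = 0" if y: "y \<in> enlargement B (\<delta> / 2)" for y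
  proof -
    obtain x where x: "x \<in> B" "dist x y < \<delta> / 2"
      using y enlargement_iff by blast
    have "\<delta> / 2 \<le> dist y a" if "a \<in> - U" for a
    proof -
      have "\<not> dist x a < \<delta>"
        using \<delta>(2) x(1) that enlargement_iff by blast
      then show ?thesis
        using dist_triangle[of x a y] x(2) by linarith
    qed
    moreover have "- U \<noteq> {}" using assms(2) by blast
    ultimately have "\<delta> / 2 \<le> infdist y (- U)"
      unfolding infdist_notempty[OF \<open>- U \<noteq> {}\<close>] by (intro cINF_greatest)
    then have "1 \<le> real k * infdist y (- U)"
      using k \<delta>(1) mult_mono[of "2 / \<delta>" "real k" "\<delta> / 2" "infdist y (- U)"] by simp
    then show ?thesis
      unfolding bump_def by simp
  qed
  then show ?thesis
    using \<delta>(1) that[of "\<delta> / 2" k] by simp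
qed

section \<open>The topology of strong uniform convergence\<close>

locale strong_bornology =
  fixes \<BB> :: "'a::metric_space set set"
  assumes bornology: "bornology \<BB>"
    and closed_base: "has_closed_base \<BB>"
    and UNIV_notin: "UNIV \<notin> \<BB>"
begin

abbreviation T where "T \<equiv> strong_uniform_topology \<BB>"

lemma topspace_T: "topspace T = continuous_functions"
  using bornology by (rule topspace_strong_uniform_topology)

lemmas openin_T = openin_strong_uniform_topology[OF bornology]

lemma Un_in: "A \<in> \<BB> \<Longrightarrow> B \<in> \<BB> \<Longrightarrow> A \<union> B \<in> \<BB>"
proof -
  assume AB: "A \<in> \<BB>" "B \<in> \<BB>"
  have "\<forall>\<F>. finite \<F> \<and> \<F> \<subseteq> \<BB> \<longrightarrow> \<Union>\<F> \<in> \<BB>"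
    using bornology by (simp add: bornology_def)
  from this[rule_format, of "{A, B}"] show ?thesis
    using AB by simp
qed

lemma singleton_in: "{x} \<in> \<BB>"
proof -
  have "x \<in> \<Union>\<BB>" using bornology by (simp add: bornology_def)
  then obtain B where "B \<in> \<BB>" "{x} \<subseteq> B" by blast
  then show ?thesis using bornology by (simp add: bornology_def)
qed

lemma insert_in: "B \<in> \<BB> \<Longrightarrow> insert x B \<in> \<BB>"
  using Un_in[OF singleton_in] by simp

text \<open>A closed member containing \<open>B\<close> is not the whole space, and a point outside
  it has a ball missing it.\<close>

lemma exists_strongly_inside_Compl_singleton:
  assumes "B \<in> \<BB>"
  obtains x where "strongly_inside B (- {x})"
proof -
  obtain C where C: "C \<in> \<BB>" "B \<subseteq> C" "closed C"
    using closed_base assms unfolding has_closed_base_def bornology_base_def by blast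
  then obtain x where "x \<notin> C"
    using UNIV_notin by (metis UNIV_eq_I)
  then show ?thesis
    using that strongly_inside_mono[OF strongly_inside_Compl_singleton[OF C(3)] C(2)] by blast
qed

definition nbhd :: "('a \<Rightarrow> real) \<Rightarrow> 'a set \<Rightarrow> real \<Rightarrow> ('a \<Rightarrow> real) set" where
  "nbhd f B \<epsilon> = {h \<in> continuous_functions. \<exists>\<delta>>0. \<forall>x\<in>enlargement B \<delta>. \<bar>f x - h x\<bar> < \<epsilon>}"

lemma nbhd_eq: "f \<in> continuous_functions \<Longrightarrow> nbhd f B \<epsilon> = strong_entourage B \<epsilon> `` {f}"
  by (auto simp: nbhd_def strong_entourage_def)

lemma nbhd_subset_openin:
  assumes "openin T W" "f \<in> W"
  obtains B \<epsilon> where "B \<in> \<BB>" "\<epsilon> > 0" "nbhd f B \<epsilon> \<subseteq> W"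
  using assms nbhd_eq unfolding openin_T by blast

text \<open>The strict bound in \<open>nbhd\<close> leaves no uniform margin around a given
  \<open>h\<close>. The union over smaller bounds does, because each \<open>h\<close> in it
  satisfies a bound \<open>\<eta> < \<epsilon>\<close>.\<close>

lemma openin_subset_nbhd:
  assumes f: "f \<in> continuous_functions" and B: "B \<in> \<BB>" and "\<epsilon> > 0"
  obtains W where "openin T W" "f \<in> W" "W \<subseteq> nbhd f B \<epsilon>"
proof -
  define W where "W = (\<Union>\<eta>\<in>{0<..<\<epsilon>}. nbhd f B \<eta>)"
  have "openin T W"
    unfolding openin_T
  proof (intro conjI ballI)
    show "W \<subseteq> continuous_functions" unfolding W_def nbhd_def by blast
    fix h assume "h \<in> W"
    then obtain \<eta> \<delta> where h: "h \<in> continuous_functions" "0 < \<eta>" "\<eta> < \<epsilon>" "\<delta> > 0"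
      "\<And>x. x \<in> enlargement B \<delta> \<Longrightarrow> \<bar>f x - h x\<bar> < \<eta>"
      unfolding W_def nbhd_def by auto
    have "nbhd h B ((\<epsilon> - \<eta>) / 2) \<subseteq> W"
    proof
      fix u assume "u \<in> nbhd h B ((\<epsilon> - \<eta>) / 2)"
      then obtain \<delta>' where u: "u \<in> continuous_functions" "\<delta>' > 0"
        "\<And>x. x \<in> enlargement B \<delta>' \<Longrightarrow> \<bar>h x - u x\<bar> < (\<epsilon> - \<eta>) / 2"
        unfolding nbhd_def by auto
      have "\<bar>f x - u x\<bar> < (\<epsilon> + \<eta>) / 2" if "x \<in> enlargement B (min \<delta> \<delta>')" for x
      proof -
        have "x \<in> enlargement B \<delta>" "x \<in> enlargement B \<delta>'"
          using that by (auto simp: enlargement_iff)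
        with h(5) u(3) have "\<bar>f x - h x\<bar> < \<eta>" "\<bar>h x - u x\<bar> < (\<epsilon> - \<eta>) / 2" by blast+
        then show ?thesis by (simp add: field_simps abs_if split: if_splits)
      qed
      then have "u \<in> nbhd f B ((\<epsilon> + \<eta>) / 2)"
        using u(1,2) h(4) unfolding nbhd_def by (auto intro!: exI[of _ "min \<delta> \<delta>'"])
      moreover have "(\<epsilon> + \<eta>) / 2 \<in> {0<..<\<epsilon>}" using h(2,3) by simp
      ultimately show "u \<in> W" unfolding W_def by blast
    qed
    then show "\<exists>B\<in>\<BB>. \<exists>\<epsilon>>0. strong_entourage B \<epsilon> `` {h} \<subseteq> W"
      using B h(1,3) nbhd_eq[OF h(1), of B "(\<epsilon> - \<eta>) / 2"] by (metis diff_gt_0_iff_gt half_gt_zero)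
  qed
  moreover have "f \<in> W"
  proof -
    have "f \<in> nbhd f B (\<epsilon> / 2)"
      using f \<open>\<epsilon> > 0\<close> by (auto simp: nbhd_def intro: zero_less_one)
    moreover have "\<epsilon> / 2 \<in> {0<..<\<epsilon>}" using \<open>\<epsilon> > 0\<close> by simp
    ultimately show ?thesis unfolding W_def by blast
  qed
  moreover have "W \<subseteq> nbhd f B \<epsilon>"
    unfolding W_def nbhd_def by (auto, meson less_trans)
  ultimately show ?thesis using that by blast
qed

lemma in_closure_of_iff:
  assumes "A \<subseteq> continuous_functions"
  shows "g \<in> T closure_of A \<longleftrightarrow>
    g \<in> continuous_functions \<and> (\<forall>B\<in>\<BB>. \<forall>\<epsilon>>0. \<exists>f\<in>A. \<exists>\<delta>>0. \<forall>x\<in>enlargement B \<delta>. \<bar>f x - g x\<bar> < \<epsilon>)"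
    (is "_ \<longleftrightarrow> ?g \<and> ?R")
proof -
  have eq: "(\<exists>f\<in>A. f \<in> nbhd g B \<epsilon>) \<longleftrightarrow> (\<exists>f\<in>A. \<exists>\<delta>>0. \<forall>x\<in>enlargement B \<delta>. \<bar>f x - g x\<bar> < \<epsilon>)" for B \<epsilon>
    using assms unfolding nbhd_def by (auto simp: abs_minus_commute)
  have "g \<in> T closure_of A \<longleftrightarrow> ?g \<and> (\<forall>W. g \<in> W \<and> openin T W \<longrightarrow> (\<exists>f\<in>A. f \<in> W))"
    unfolding in_closure_of topspace_T by blast
  also have "\<dots> \<longleftrightarrow> ?g \<and> (\<forall>B\<in>\<BB>. \<forall>\<epsilon>>0. \<exists>f\<in>A. f \<in> nbhd g B \<epsilon>)"
  proof (intro conj_cong refl iffI allI impI ballI)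
    fix B and \<epsilon> :: real
    assume "?g" "\<forall>W. g \<in> W \<and> openin T W \<longrightarrow> (\<exists>f\<in>A. f \<in> W)" "B \<in> \<BB>" "\<epsilon> > 0"
    then show "\<exists>f\<in>A. f \<in> nbhd g B \<epsilon>"
      by (metis openin_subset_nbhd subsetD)
  next
    fix W assume "\<forall>B\<in>\<BB>. \<forall>\<epsilon>>0. \<exists>f\<in>A. f \<in> nbhd g B \<epsilon>" "g \<in> W \<and> openin T W"
    then show "\<exists>f\<in>A. f \<in> W"
      by (metis nbhd_subset_openin subsetD)
  qed
  finally show ?thesis unfolding eq .
qed

lemma limitin_T:
  assumes "g \<in> continuous_functions" "range s \<subseteq> continuous_functions"
    and "\<And>B \<epsilon>. B \<in> \<BB> \<Longrightarrow> \<epsilon> > 0 \<Longrightarrow> \<exists>N. \<forall>n\<ge>N. \<exists>\<delta>>0. \<forall>x\<in>enlargement B \<delta>. \<bar>s n x - g x\<bar> < \<epsilon>"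
  shows "limitin T s g sequentially"
  unfolding limitin_sequentially topspace_T
proof (intro conjI allI impI assms(1), elim conjE)
  fix W assume "openin T W" "g \<in> W"
  then obtain B \<epsilon> where B: "B \<in> \<BB>" "\<epsilon> > 0" "nbhd g B \<epsilon> \<subseteq> W"
    using nbhd_subset_openin by blast
  then obtain N where N: "\<forall>n\<ge>N. \<exists>\<delta>>0. \<forall>x\<in>enlargement B \<delta>. \<bar>s n x - g x\<bar> < \<epsilon>"
    using assms(3) by blast
  have "\<forall>n\<ge>N. s n \<in> nbhd g B \<epsilon>"
    using N assms(2) unfolding nbhd_def by (auto simp: abs_minus_commute)
  then show "\<exists>N. \<forall>n\<ge>N. s n \<in> W"
    using B(3) by blast
qed

text \<open>Singletons belong to the bornology, so the topology is at least as fine as that of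
  pointwise convergence.\<close>

lemma openin_evaluation:
  assumes "open S"
  shows "openin T {f \<in> continuous_functions. f x \<in> S}"
  unfolding openin_T
proof (intro conjI ballI)
  fix f assume f: "f \<in> {f \<in> continuous_functions. f x \<in> S}"
  then obtain \<epsilon> where \<epsilon>: "\<epsilon> > 0" "ball (f x) \<epsilon> \<subseteq> S"
    using assms open_contains_ball by blast
  have "x \<in> enlargement {x} \<delta>" if "\<delta> > 0" for \<delta>
    using that by (simp add: enlargement_iff)
  then have "nbhd f {x} \<epsilon> \<subseteq> {f \<in> continuous_functions. f x \<in> S}"
    using \<epsilon>(2) unfolding nbhd_def by (fastforce simp: dist_real_def)
  then show "\<exists>B\<in>\<BB>. \<exists>\<epsilon>>0. strong_entourage B \<epsilon> `` {f} \<subseteq> {f \<in> continuous_functions. f x \<in> S}"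
    using singleton_in \<epsilon>(1) f nbhd_eq by blast
qed blast

lemma Hausdorff_T: "Hausdorff_space T"
  unfolding Hausdorff_space_def topspace_T
proof (intro allI impI, elim conjE)
  fix f g :: "'a \<Rightarrow> real" assume fg: "f \<in> continuous_functions" "g \<in> continuous_functions" "f \<noteq> g"
  then obtain x where "f x \<noteq> g x" by blast
  from hausdorff[OF this]
  obtain U V where UV: "open U" "open V" "f x \<in> U" "g x \<in> V" "U \<inter> V = {}"
    by blast
  show "\<exists>U V. openin T U \<and> openin T V \<and> f \<in> U \<and> g \<in> V \<and> disjnt U V"
    using openin_evaluation[OF UV(1), of x] openin_evaluation[OF UV(2), of x] UV fg
    by (intro exI[of _ "{f \<in> continuous_functions. f x \<in> U}"] exI[of _ "{f \<in> continuous_functions. f x \<in> V}"])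
      (auto simp: disjnt_def)
qed

section \<open>Strong covers and gamma covers\<close>

lemma open_strong_cover_iff:
  "open_strong_cover \<BB> \<U> \<longleftrightarrow> (\<forall>U\<in>\<U>. open U) \<and> UNIV \<notin> \<U> \<and> (\<forall>B\<in>\<BB>. \<exists>U\<in>\<U>. strongly_inside B U)"
  (is "_ \<longleftrightarrow> ?R")
proof
  assume ?R
  then have "\<exists>U\<in>\<U>. x \<in> U" for x
    using singleton_in[of x] strongly_inside_subset by blast
  with \<open>?R\<close> show "open_strong_cover \<BB> \<U>"
    unfolding open_strong_cover_def strongly_inside_def by blast
qed (auto simp: open_strong_cover_def strongly_inside_def)

text \<open>The range is infinite because a set occurring infinitely often would omit some point for
  infinitely many indices, contrary to the condition for that singleton.\<close>

lemma strong_gamma_coverI: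
  assumes op: "\<And>n. open (U n)" and ne: "\<And>n. U n \<noteq> UNIV"
    and ins: "\<And>B. B \<in> \<BB> \<Longrightarrow> finite {n::nat. \<not> strongly_inside B (U n)}"
  shows "strong_gamma_cover \<BB> (range U)"
  unfolding strong_gamma_cover_def
proof (intro conjI)
  have fin: "finite {n. x \<notin> U n}" for x
    by (rule finite_subset[OF _ ins[OF singleton_in[of x]]]) (use strongly_inside_subset in blast)
  show "infinite (range U)"
  proof
    assume "finite (range U)"
    then obtain V where "infinite {n. U n = V}"
      using pigeonhole_infinite[of UNIV U] by auto
    moreover obtain x where "x \<notin> V"
      using ne calculation by (metis (mono_tags, lifting) UNIV_eq_I empty_Collect_eq finite.emptyI)
    ultimately show False
      using fin[of x] finite_subset[of "{n. U n = V}" "{n. x \<notin> U n}"] by blast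
  qed
  have "\<exists>n. x \<in> U n" for x
  proof (rule ccontr)
    assume "\<not> ?thesis"
    then have "{n. x \<notin> U n} = UNIV" by blast
    with fin[of x] show False by simp
  qed
  then show "\<Union> (range U) = UNIV" by auto
  show "\<exists>V :: nat \<Rightarrow> 'a set. range U = range V \<and> (\<forall>B\<in>\<BB>. \<exists>n\<^sub>0 \<delta>. \<forall>n\<ge>n\<^sub>0. 0 < \<delta> n \<and> enlargement B (\<delta> n) \<subseteq> V n)"
  proof (rule exI[of _ U], intro conjI refl ballI)
    fix B assume "B \<in> \<BB>"
    then obtain N where "\<forall>n\<in>{n. \<not> strongly_inside B (U n)}. n < N"
      using ins finite_nat_set_iff_bounded by blast
    then have "\<exists>\<delta>>0. enlargement B \<delta> \<subseteq> U n" if "n \<ge> N" for n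
      using that unfolding strongly_inside_def by force
    then show "\<exists>n\<^sub>0 \<delta>. \<forall>n\<ge>n\<^sub>0. 0 < \<delta> n \<and> enlargement B (\<delta> n) \<subseteq> U n"
      by metis
  qed
qed (use op ne in auto)

text \<open>Counting members instead of indices frees the property from the witnessing
  enumeration.\<close>

lemma strong_gamma_cover_finite_exceptions:
  assumes "strong_gamma_cover \<BB> \<U>" "B \<in> \<BB>"
  shows "finite {U\<in>\<U>. \<not> strongly_inside B U}"
proof -
  obtain U :: "nat \<Rightarrow> 'a set" and N \<delta> where "\<U> = range U" "\<forall>n\<ge>N. \<delta> n > 0 \<and> enlargement B (\<delta> n) \<subseteq> U n"
    using assms unfolding strong_gamma_cover_def by metis
  then have "{U\<in>\<U>. \<not> strongly_inside B U} \<subseteq> U ` {..<N}"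
    unfolding strongly_inside_def by (auto intro!: imageI) (metis not_le)
  then show ?thesis
    using finite_subset by blast
qed

section \<open>From selection to the Frechet-Urysohn property\<close>

lemma frechet_urysohn_if_selection:
  assumes sel: "selection_S1 {\<U>. open_strong_cover \<BB> \<U>} {\<U>. strong_gamma_cover \<BB> \<U>}"
  shows "frechet_urysohn_space T"
  unfolding frechet_urysohn_space_def
proof (intro allI impI ballI)
  fix A g assume A: "A \<subseteq> topspace T" and g: "g \<in> T closure_of A"
  have AC: "A \<subseteq> continuous_functions" using A topspace_T by simp
  have gC: "g \<in> continuous_functions"
    and near: "\<And>B \<epsilon>. B \<in> \<BB> \<Longrightarrow> \<epsilon> > 0 \<Longrightarrow> \<exists>f\<in>A. \<exists>\<delta>>0. \<forall>x\<in>enlargement B \<delta>. \<bar>f x - g x\<bar> < \<epsilon>"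
    using g unfolding in_closure_of_iff[OF AC] by blast+
  define V where "V = (\<lambda>n f. {x. \<bar>f x - g x\<bar> < 1 / real (Suc n)})"
  have V_mono: "V m f \<subseteq> V n f" if "n \<le> m" for m n f
  proof -
    have "1 / real (Suc m) \<le> 1 / real (Suc n)"
      using that by (simp add: frac_le)
    then show ?thesis unfolding V_def by auto
  qed
  show "\<exists>s :: nat \<Rightarrow> 'a \<Rightarrow> real. range s \<subseteq> A \<and> limitin T s g sequentially"
  \<comment> \<open>A strong cover must not contain the whole space. If some \<open>V m f\<close> is
    the whole space for arbitrarily large \<open>m\<close>, functions in \<open>A\<close> converge
    to \<open>g\<close> uniformly everywhere; otherwise a shift by \<open>N\<close> skips the bad
    indices.\<close>
  proof (cases "\<forall>n. \<exists>m\<ge>n. \<exists>f\<in>A. V m f = UNIV")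
    case True
    then have "\<forall>n. \<exists>f\<in>A. V n f = UNIV"
      using V_mono by (metis top.extremum_uniqueI)
    then obtain s where s: "\<And>n. s n \<in> A" "\<And>n. V n (s n) = UNIV"
      by metis
    have "limitin T s g sequentially"
    proof (rule limitin_T[OF gC])
      show "range s \<subseteq> continuous_functions" using s(1) AC by blast
      fix B and \<epsilon> :: real assume "\<epsilon> > 0"
      then obtain N where N: "1 / real (Suc N) < \<epsilon>"
        using nat_approx_posE by blast
      have "\<bar>s n x - g x\<bar> < \<epsilon>" if "n \<ge> N" for n x
      proof -
        have "x \<in> V N (s n)"
          using V_mono[OF that] s(2)[of n] by blast
        then show ?thesis using N unfolding V_def by simp
      qed
      then show "\<exists>N. \<forall>n\<ge>N. \<exists>\<delta>>0. \<forall>x\<in>enlargement B \<delta>. \<bar>s n x - g x\<bar> < \<epsilon>"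
        using zero_less_one by blast
    qed
    then show ?thesis using s(1) by blast
  next
    case False
    then obtain N where N: "\<And>n f. n \<ge> N \<Longrightarrow> f \<in> A \<Longrightarrow> V n f \<noteq> UNIV"
      by blast
    have "open (V n f)" if "f \<in> A" for n f
    proof -
      have "continuous_on UNIV (\<lambda>x. \<bar>f x - g x\<bar>)"
        using that AC gC unfolding continuous_functions_def by (intro continuous_intros) auto
      then show ?thesis unfolding V_def by (intro open_Collect_less continuous_on_const)
    qed
    moreover have "\<exists>f\<in>A. strongly_inside B (V n f)" if "B \<in> \<BB>" for B n
      using near[OF that, of "1 / real (Suc n)"] unfolding strongly_inside_def V_def by fastforce
    ultimately have "open_strong_cover \<BB> (V (n + N) ` A)" for n
      unfolding open_strong_cover_iff using N[of "n + N"] by fastforce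
    then obtain a where a: "\<And>n. a n \<in> V (n + N) ` A" and gamma: "strong_gamma_cover \<BB> (range a)"
      using sel[unfolded selection_S1_def, rule_format, of "\<lambda>n. V (n + N) ` A"] by auto
    obtain f where f: "\<And>n. f n \<in> A" "\<And>n. a n = V (n + N) (f n)"
      using a unfolding image_iff by metis
    \<comment> \<open>Keeping first occurrences makes \<open>a\<close> injective on
      \<open>J\<close>, so finitely many exceptional members mean finitely many exceptional
      indices.\<close>
    define J where "J = {n. \<forall>m<n. a m \<noteq> a n}"
    have inj: "inj_on a J"
      unfolding inj_on_def J_def by (auto, metis nat_neq_iff)
    have "range a \<subseteq> a ` J"
    proof (intro subsetI)
      fix u assume "u \<in> range a"
      then obtain n where "a n = u" by blast
      define l where "l = (LEAST n. a n = u)"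
      have "a l = u" "\<And>m. m < l \<Longrightarrow> a m \<noteq> u"
        unfolding l_def by (rule LeastI, fact) (rule not_less_Least)
      then show "u \<in> a ` J" unfolding J_def by blast
    qed
    moreover have "infinite (range a)"
      using gamma by (simp add: strong_gamma_cover_def)
    ultimately have J: "infinite J"
      using finite_subset by blast
    define r where "r = enumerate J"
    have r: "strict_mono r" "\<And>n. r n \<in> J"
      unfolding r_def using J strict_mono_enumerate enumerate_in_set by blast+
    have "limitin T (f \<circ> r) g sequentially"
    proof (rule limitin_T[OF gC])
      show "range (f \<circ> r) \<subseteq> continuous_functions" using f(1) AC by auto
      fix B and \<epsilon> :: real assume "B \<in> \<BB>" "\<epsilon> > 0"
      obtain M where M: "1 / real (Suc M) < \<epsilon>"
        using \<open>\<epsilon> > 0\<close> nat_approx_posE by blast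
      have "finite {U\<in>range a. \<not> strongly_inside B U}"
        using strong_gamma_cover_finite_exceptions[OF gamma \<open>B \<in> \<BB>\<close>] .
      then have "finite (a ` {n\<in>J. \<not> strongly_inside B (a n)})"
        by (rule finite_subset[rotated]) blast
      then have "finite {n\<in>J. \<not> strongly_inside B (a n)}"
        by (rule finite_imageD) (rule inj_on_subset[OF inj], blast)
      then obtain L where L: "\<And>n. n \<in> J \<Longrightarrow> n \<ge> L \<Longrightarrow> strongly_inside B (a n)"
        using finite_nat_set_iff_bounded by (metis (mono_tags, lifting) leD mem_Collect_eq)
      have "\<exists>\<delta>>0. \<forall>x\<in>enlargement B \<delta>. \<bar>(f \<circ> r) n x - g x\<bar> < \<epsilon>" if "n \<ge> max L M" for n
      proof -
        have "r n \<ge> L" "r n + N \<ge> M"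
          using seq_suble[OF r(1), of n] that by auto
        then have "strongly_inside B (V M (f (r n)))"
          using strongly_inside_mono[OF L[OF r(2)] order_refl] f(2) V_mono by metis
        then show ?thesis
          using M unfolding strongly_inside_def V_def by fastforce
      qed
      then show "\<exists>N. \<forall>n\<ge>N. \<exists>\<delta>>0. \<forall>x\<in>enlargement B \<delta>. \<bar>(f \<circ> r) n x - g x\<bar> < \<epsilon>"
        by blast
    qed
    then show ?thesis
      using f(1) by (intro exI[of _ "f \<circ> r"]) auto
  qed
qed

section \<open>From gamma sequences in single covers to the selection principle\<close>

lemma selection_if_gamma_subsequences:
  assumes gamma: "\<And>\<U>. open_strong_cover \<BB> \<U> \<Longrightarrow>
    \<exists>U :: nat \<Rightarrow> 'a set. (\<forall>n. U n \<in> \<U>) \<and> (\<forall>B\<in>\<BB>. finite {n. \<not> strongly_inside B (U n)})"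
  shows "selection_S1 {\<U>. open_strong_cover \<BB> \<U>} {\<U>. strong_gamma_cover \<BB> \<U>}"
proof -
  have "open_strong_cover \<BB> (range (\<lambda>x. - {x}))"
    unfolding open_strong_cover_iff using exists_strongly_inside_Compl_singleton by blast
  from gamma[OF this] obtain U :: "nat \<Rightarrow> 'a set" where
    U: "\<And>n. U n \<in> range (\<lambda>x. - {x})" "\<And>B. B \<in> \<BB> \<Longrightarrow> finite {n. \<not> strongly_inside B (U n)}"
    by blast
  then obtain x where "\<And>n. U n = - {x n}"
    unfolding image_iff by metis
  with U(2) have x: "\<And>B. B \<in> \<BB> \<Longrightarrow> finite {n. \<not> strongly_inside B (- {x n})}"
    by simp
  show ?thesis
    unfolding selection_S1_def mem_Collect_eq
  proof (intro allI impI)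
    fix A :: "nat \<Rightarrow> 'a set set"
    assume A: "\<forall>n. open_strong_cover \<BB> (A n)"
    \<comment> \<open>Removing \<open>x n\<close> marks a member with its length: all members of
      length \<open>n\<close> miss the same point.\<close>
    define \<V> where "\<V> = {(\<Inter>i\<le>n. u i) \<inter> - {x n} | n u. \<forall>i. u i \<in> A i}"
    have "open_strong_cover \<BB> \<V>"
      unfolding open_strong_cover_iff
    proof (intro conjI ballI)
      show "open V" if "V \<in> \<V>" for V
      proof -
        obtain n u where "V = (\<Inter>i\<le>n. u i) \<inter> - {x n}" "\<And>i. u i \<in> A i"
          using \<open>V \<in> \<V>\<close> unfolding \<V>_def by blast
        moreover have "\<And>i. open (u i)"
          using A calculation(2) open_strong_cover_iff by blast
        ultimately show ?thesis by (simp add: open_INT open_Int open_Compl)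
      qed
      show "UNIV \<notin> \<V>" unfolding \<V>_def by blast
      fix B assume B: "B \<in> \<BB>"
      then have "\<forall>i. \<exists>u\<in>A i. strongly_inside B u"
        using A open_strong_cover_iff by blast
      then obtain u where u: "\<And>i. u i \<in> A i" "\<And>i. strongly_inside B (u i)"
        by metis
      obtain n where n: "strongly_inside B (- {x n})"
        using x[OF B] ex_new_if_finite[OF infinite_UNIV_nat] by blast
      have "(\<Inter>i\<le>n. u i) \<inter> - {x n} \<in> \<V>"
        unfolding \<V>_def using u(1) by blast
      moreover have "strongly_inside B ((\<Inter>i\<le>n. u i) \<inter> - {x n})"
        using n u(2) by (intro strongly_inside_Int strongly_inside_Inter) auto
      ultimately show "\<exists>V\<in>\<V>. strongly_inside B V" by blast
    qed
    from gamma[OF this] obtain W :: "nat \<Rightarrow> 'a set" where W: "\<And>k. W k \<in> \<V>"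
      "\<And>B. B \<in> \<BB> \<Longrightarrow> finite {k. \<not> strongly_inside B (W k)}"
      by blast
    have "\<exists>n u. W k = (\<Inter>i\<le>n. u i) \<inter> - {x n} \<and> (\<forall>i. u i \<in> A i)" for k
      using W(1)[of k] unfolding \<V>_def by blast
    then obtain n u where nu: "\<And>k. W k = (\<Inter>i\<le>n k. u k i) \<inter> - {x (n k)}" "\<And>k i. u k i \<in> A i"
      by metis
    \<comment> \<open>All \<open>W k\<close> with \<open>n k = m\<close> miss \<open>x m\<close>,
      and only finitely many \<open>W k\<close> can do so. Hence \<open>n\<close> is
      unbounded.\<close>
    have fib: "finite {k. n k = m}" for m
      by (rule finite_subset[OF _ W(2)[OF singleton_in[of "x m"]]])
        (use strongly_inside_subset nu(1) in blast)
    have "\<exists>k. m \<le> n k" for m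
    proof (rule ccontr)
      assume "\<not> ?thesis"
      then have "UNIV \<subseteq> (\<Union>j<m. {k. n k = j})" by (auto simp: not_le)
      then show False
        using fib by (meson finite_UN finite_lessThan finite_subset infinite_UNIV_nat)
    qed
    then obtain \<kappa> where \<kappa>: "\<And>m. m \<le> n (\<kappa> m)" by metis
    have "strong_gamma_cover \<BB> (range (\<lambda>m. u (\<kappa> m) m))"
    proof (rule strong_gamma_coverI)
      show "open (u (\<kappa> m) m)" "u (\<kappa> m) m \<noteq> UNIV" for m
        using A[rule_format, of m] nu(2)[of "\<kappa> m" m] unfolding open_strong_cover_iff by metis+
      fix B assume B: "B \<in> \<BB>"
      have "W (\<kappa> m) \<subseteq> u (\<kappa> m) m" for m
        unfolding nu(1) using \<kappa>[of m] by blast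
      then have "\<not> strongly_inside B (W (\<kappa> m))" if "\<not> strongly_inside B (u (\<kappa> m) m)" for m
        using that strongly_inside_mono by blast
      \<comment> \<open>An exceptional \<open>m\<close> yields an exceptional
        \<open>k = \<kappa> m\<close> with \<open>m \<le> n k\<close>, so finitely many
        \<open>k\<close> bound all such \<open>m\<close>.\<close>
      then have "{m. \<not> strongly_inside B (u (\<kappa> m) m)} \<subseteq> (\<Union>k\<in>{k. \<not> strongly_inside B (W k)}. {..n k})"
        using \<kappa> by auto
      then show "finite {m. \<not> strongly_inside B (u (\<kappa> m) m)}"
        using W(2)[OF B] by (meson finite_UN_I finite_atMost finite_subset)
    qed
    then show "\<exists>a. (\<forall>n. a n \<in> A n) \<and> strong_gamma_cover \<BB> (range a)"
      using nu(2) by (intro exI[of _ "\<lambda>m. u (\<kappa> m) m"]) blast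
  qed
qed

section \<open>Compact sets of functions and countable tightness\<close>

lemma continuous_map_evaluation: "continuous_map T euclideanreal (\<lambda>f. f x)"
  unfolding continuous_map_def topspace_T using openin_evaluation[of _ x] by simp

lemma compactin_evaluation_bounded:
  assumes "compactin T K" "finite F"
  obtains n :: nat where "\<And>f x. f \<in> K \<Longrightarrow> x \<in> F \<Longrightarrow> f x < real n"
proof -
  have "bounded ((\<lambda>f. f x) ` K)" for x
    using image_compactin[OF assms(1) continuous_map_evaluation, of x]
    by (simp add: compact_imp_bounded)
  then have "bounded (\<Union>x\<in>F. (\<lambda>f. f x) ` K)"
    using assms(2) by blast
  then obtain b where b: "\<And>f x. f \<in> K \<Longrightarrow> x \<in> F \<Longrightarrow> norm (f x) \<le> b"
    unfolding bounded_iff by blast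
  obtain n :: nat where "b < real n" using reals_Archimedean2 by blast
  then show ?thesis using that b by (metis abs_le_D1 le_less_trans real_norm_def)
qed

lemma openin_finite_evaluations_less:
  "finite F \<Longrightarrow> openin T {f \<in> continuous_functions. \<forall>x\<in>F. f x < c}"
proof (induction F rule: finite_induct)
  case empty
  then show ?case using openin_topspace[of T] by (simp add: topspace_T)
next
  case (insert y F)
  have "{f \<in> continuous_functions. \<forall>x\<in>insert y F. f x < c} =
    {f \<in> continuous_functions. f y \<in> {..<c}} \<inter> {f \<in> continuous_functions. \<forall>x\<in>F. f x < c}"
    by auto
  then show ?case
    using insert.IH openin_evaluation[of "{..<c}" y] by (simp only: openin_Int open_lessThan)
qed

text \<open>McCoy's argument: a function that exceeds \<open>n\<close> on all but \<open>n\<close> of the sets \<open>F a\<close> is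
  not in a given compact set once \<open>n\<close> is large, because compact sets are pointwise bounded
  and, \<open>I\<close> being uncountable, one bound serves for infinitely many \<open>a\<close>.\<close>

lemma k_space_no_uncountable_locally_finite_family:
  assumes k: "k_space T" and I: "uncountable I" and F: "\<And>a. a \<in> I \<Longrightarrow> finite (F a)"
    and loc: "\<And>B. B \<in> \<BB> \<Longrightarrow> \<exists>\<delta>>0. finite {a\<in>I. F a \<subseteq> enlargement B \<delta>}"
  shows False
proof -
  define W where "W = (\<lambda>n J. {f \<in> continuous_functions. \<forall>x\<in>(\<Union>a\<in>J. F a). f x < real n})"
  \<comment> \<open>The lower bound keeps the zero function out of every \<open>A n\<close> but
    tends to 0. The second clause says that \<open>f\<close> stays below \<open>n\<close> on at most
    \<open>n\<close> of the sets \<open>F a\<close>.\<close>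
  define A where "A = (\<lambda>n. {f \<in> continuous_functions. (\<forall>x. 1 / real (Suc n) \<le> f x) \<and>
    (\<forall>J\<subseteq>I. finite J \<and> card J = Suc n \<longrightarrow> f \<notin> W n J)})"
  have AC: "\<Union>(range A) \<subseteq> continuous_functions" unfolding A_def by blast
  have closed: "closedin T (A n)" for n
  proof -
    have "openin T (W n J)" if "finite J" "J \<subseteq> I" for J
      unfolding W_def using that F by (intro openin_finite_evaluations_less) blast
    then have "openin T (\<Union>(W n ` {J. J \<subseteq> I \<and> finite J \<and> card J = Suc n}))"
      by blast
    moreover have "openin T (\<Union>x. {f \<in> continuous_functions. f x \<in> {..<1 / real (Suc n)}})"
      using openin_evaluation[OF open_lessThan] by blast
    ultimately have "openin T ((\<Union>x. {f \<in> continuous_functions. f x \<in> {..<1 / real (Suc n)}})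
        \<union> \<Union>(W n ` {J. J \<subseteq> I \<and> finite J \<and> card J = Suc n}))"
      by (rule openin_Un[rotated])
    moreover have "topspace T - A n = (\<Union>x. {f \<in> continuous_functions. f x \<in> {..<1 / real (Suc n)}})
        \<union> \<Union>(W n ` {J. J \<subseteq> I \<and> finite J \<and> card J = Suc n})"
      unfolding A_def topspace_T W_def by (auto simp: not_le) (meson not_le)+
    ultimately show ?thesis
      unfolding closedin_def using AC topspace_T by (metis UN_subset_iff UNIV_I)
  qed
  have "(\<lambda>x. 0) \<in> T closure_of (\<Union>(range A))"
    unfolding in_closure_of_iff[OF AC]
  proof (intro conjI ballI allI impI)
    show "(\<lambda>x. 0) \<in> continuous_functions" by (simp add: continuous_functions_def)
    fix B' and \<epsilon> :: real assume "B' \<in> \<BB>" "\<epsilon> > 0"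
    \<comment> \<open>Adding a point makes the distance to \<open>B\<close> genuine, since
      \<open>infdist\<close> to the empty set is 0.\<close>
    define B where "B = insert undefined B'"
    have B: "B \<in> \<BB>" "B \<noteq> {}"
      unfolding B_def using \<open>B' \<in> \<BB>\<close> insert_in by auto
    then obtain \<delta> where \<delta>: "\<delta> > 0" "finite {a\<in>I. F a \<subseteq> enlargement B \<delta>}"
      using loc by blast
    obtain N0 where N0: "1 / real (Suc N0) < \<epsilon> / 2"
      using nat_approx_posE[of "\<epsilon> / 2"] \<open>\<epsilon> > 0\<close> by auto
    \<comment> \<open>Among any \<open>Suc N\<close> sets \<open>F a\<close> one leaves the
      enlargement, and there \<open>f\<close> reaches \<open>N\<close>.\<close>
    define N where "N = max N0 (card {a\<in>I. F a \<subseteq> enlargement B \<delta>})"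
    have "1 / real (Suc N) \<le> 1 / real (Suc N0)"
      by (simp add: N_def frac_le)
    with N0 have N: "1 / real (Suc N) < \<epsilon> / 2" by linarith
    define f where "f = (\<lambda>x. 1 / real (Suc N) + real N * infdist x B / \<delta>)"
    have ge: "1 / real (Suc N) \<le> f x" for x
      unfolding f_def using \<delta>(1) infdist_nonneg[of x B] by simp
    have large: "real N \<le> f x" if "x \<notin> enlargement B \<delta>" for x
    proof -
      have "\<delta> \<le> dist x b" if "b \<in> B" for b
        using \<open>x \<notin> enlargement B \<delta>\<close> that unfolding enlargement_iff by (force simp: dist_commute)
      then have "\<delta> \<le> infdist x B"
        unfolding infdist_notempty[OF B(2)] by (intro cINF_greatest B(2))
      then have "real N * 1 \<le> real N * (infdist x B / \<delta>)"
        using \<delta>(1) by (intro mult_left_mono) auto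
      moreover have "0 \<le> 1 / real (Suc N)" by simp
      ultimately show ?thesis unfolding f_def times_divide_eq_right by linarith
    qed
    have "f \<in> continuous_functions"
      unfolding continuous_functions_def f_def using \<delta>(1) by (auto intro!: continuous_intros)
    moreover have "f \<notin> W N J" if J: "J \<subseteq> I" "finite J" "card J = Suc N" for J
    proof
      assume "f \<in> W N J"
      then have "F a \<subseteq> enlargement B \<delta>" if "a \<in> J" for a
        using large that unfolding W_def by force
      then have "card J \<le> card {a\<in>I. F a \<subseteq> enlargement B \<delta>}"
        using J(1) \<delta>(2) by (intro card_mono) auto
      then show False using J(3) unfolding N_def by simp
    qed
    ultimately have "f \<in> \<Union>(range A)"
      unfolding A_def using ge by blast
    \<comment> \<open>The radius makes the distance term of \<open>f\<close> at most
      \<open>\<epsilon> / 2\<close>; the constant term is below \<open>\<epsilon> / 2\<close> by the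
      choice of \<open>N0\<close>.\<close>
    moreover have "\<bar>f x - 0\<bar> < \<epsilon>" if x: "x \<in> enlargement B' (\<delta> * \<epsilon> / (2 * real (Suc N)))" for x
    proof -
      obtain b where b: "b \<in> B" "dist b x < \<delta> * \<epsilon> / (2 * real (Suc N))"
        using x unfolding enlargement_iff B_def by blast
      then have "infdist x B < \<delta> * \<epsilon> / (2 * real (Suc N))"
        using infdist_le[OF b(1), of x] by (simp add: dist_commute)
      then have "infdist x B / \<delta> \<le> \<epsilon> / 2 / real (Suc N)"
        using \<delta>(1) by (simp add: field_simps)
      then have "real N * (infdist x B / \<delta>) \<le> real N * (\<epsilon> / 2 / real (Suc N))"
        by (intro mult_left_mono) auto
      also have "\<dots> \<le> \<epsilon> / 2"
        using \<open>\<epsilon> > 0\<close> by (simp add: field_simps)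
      finally have "f x < \<epsilon>" unfolding f_def times_divide_eq_right using N by linarith
      moreover have "0 < f x" using ge[of x] by (smt (verit) divide_pos_pos of_nat_0_less_iff zero_less_Suc)
      ultimately show ?thesis by simp
    qed
    moreover have "\<delta> * \<epsilon> / (2 * real (Suc N)) > 0"
      using \<delta>(1) \<open>\<epsilon> > 0\<close> by simp
    ultimately show "\<exists>f\<in>\<Union>(range A). \<exists>\<delta>>0. \<forall>x\<in>enlargement B' \<delta>. \<bar>f x - 0\<bar> < \<epsilon>"
      by blast
  qed
  moreover have "(\<lambda>x. 0) \<notin> \<Union>(range A)"
    unfolding A_def by (auto simp: divide_le_0_iff)
  ultimately have "\<not> closedin T (\<Union>(range A))"
    using closure_of_eq by metis
  then obtain K where K: "compactin T K" "\<not> closedin (subtopology T K) (K \<inter> \<Union>(range A))"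
    using k AC unfolding k_space topspace_T by blast
  have "\<forall>a\<in>I. \<exists>n::nat. \<forall>f\<in>K. \<forall>x\<in>F a. f x < real n"
    using compactin_evaluation_bounded[OF K(1) F] by metis
  then obtain M :: "_ \<Rightarrow> nat" where M: "\<And>a f x. a \<in> I \<Longrightarrow> f \<in> K \<Longrightarrow> x \<in> F a \<Longrightarrow> f x < real (M a)"
    by metis
  have "\<exists>m. infinite {a\<in>I. M a = m}"
  proof (rule ccontr)
    assume "\<not> ?thesis"
    then have "countable (\<Union>m. {a\<in>I. M a = m})"
      by (intro countable_UN) (auto intro: countable_finite)
    moreover have "(\<Union>m. {a\<in>I. M a = m}) = I" by blast
    ultimately show False using I by metis
  qed
  then obtain m where m: "infinite {a\<in>I. M a = m}" by blast
  have "f \<notin> A n" if "f \<in> K" "m \<le> n" for f n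
  proof
    assume "f \<in> A n"
    obtain J where J: "J \<subseteq> {a\<in>I. M a = m}" "finite J" "card J = Suc n"
      using infinite_arbitrarily_large[OF m] by blast
    have "f \<in> W n J"
      using \<open>f \<in> A n\<close> M[OF _ \<open>f \<in> K\<close>] J(1) \<open>m \<le> n\<close> unfolding A_def W_def by fastforce
    then show False using \<open>f \<in> A n\<close> J unfolding A_def by blast
  qed
  \<comment> \<open>Only \<open>A n\<close> with \<open>n < m\<close> can meet \<open>K\<close>, so
    the trace is that of a finite union of closed sets.\<close>
  then have "K \<inter> \<Union>(range A) = K \<inter> (\<Union>n<m. A n)"
    by (force simp: not_le)
  moreover have "closedin T (\<Union>n<m. A n)"
    using closed by (intro closedin_Union) auto
  ultimately show False
    using K(2) closedin_subtopology_Int_closed by metis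
qed

text \<open>The closure of \<open>C\<close> is a closed part of \<open>K\<close>, hence compact, and
  misses \<open>g\<close>. The open conditions of differing from \<open>g\<close> at a point by more
  than \<open>1 / real (Suc n)\<close> cover it, and finitely many suffice.\<close>

lemma compactin_pointwise_separated:
  assumes K: "compactin T K" "C \<subseteq> K" and g: "g \<in> continuous_functions" "g \<notin> T closure_of C"
  obtains n :: nat and F where "finite F" "\<And>f. f \<in> C \<Longrightarrow> \<exists>x\<in>F. 1 / real (Suc n) < \<bar>f x - g x\<bar>"
proof -
  define V where "V = (\<lambda>(x, n). {f \<in> continuous_functions. f x \<in> {t. 1 / real (Suc n) < \<bar>t - g x\<bar>}})"
  have "open {t. c < \<bar>t - d\<bar>}" for c d :: real
    by (intro open_Collect_less continuous_intros)
  then have "openin T (V p)" for p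
    unfolding V_def by (cases p) (simp only: prod.case openin_evaluation)
  moreover have "compactin T (T closure_of C)"
    using K compactin_imp_closedin[OF Hausdorff_T K(1)] closed_compactin closure_of_minimal closedin_closure_of
    by metis
  moreover have "T closure_of C \<subseteq> \<Union>(V ` UNIV)"
  proof
    fix h assume h: "h \<in> T closure_of C"
    then have "h \<in> continuous_functions" using in_closure_of topspace_T by metis
    have "h \<noteq> g" using h g(2) by blast
    then obtain x where "0 < \<bar>h x - g x\<bar>" by auto
    then obtain n where "1 / real (Suc n) < \<bar>h x - g x\<bar>" using nat_approx_posE by blast
    then have "h \<in> V (x, n)" using \<open>h \<in> continuous_functions\<close> unfolding V_def by simp
    then show "h \<in> \<Union>(V ` UNIV)" by blast
  qed
  ultimately obtain \<F> where "finite \<F>" "\<F> \<subseteq> range V" "T closure_of C \<subseteq> \<Union>\<F>"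
    using compactinD[of T "T closure_of C" "range V"] by blast
  then obtain P where P: "finite P" "T closure_of C \<subseteq> \<Union>(V ` P)"
    using finite_subset_image by metis
  \<comment> \<open>The \<open>0\<close> provides a maximum when \<open>P\<close> is empty.\<close>
  define n where "n = Max (insert 0 (snd ` P))"
  have "C \<subseteq> T closure_of C"
    using K compactin_subset_topspace by (intro closure_of_subset) blast
  have "\<exists>x\<in>fst ` P. 1 / real (Suc n) < \<bar>f x - g x\<bar>" if "f \<in> C" for f
  proof -
    obtain x m where xm: "(x, m) \<in> P" "f \<in> V (x, m)"
      using subsetD[OF P(2) subsetD[OF \<open>C \<subseteq> T closure_of C\<close> \<open>f \<in> C\<close>]] by (metis UN_E surj_pair)
    have "m \<le> n"
      unfolding n_def using P(1) xm(1) by (intro Max_ge) force+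
    then have "1 / real (Suc n) \<le> 1 / real (Suc m)" by (simp add: frac_le)
    also have "1 / real (Suc m) < \<bar>f x - g x\<bar>"
      using xm(2) unfolding V_def by simp
    finally show ?thesis using xm(1) by force
  qed
  then show ?thesis using that[of "fst ` P"] P(1) by blast
qed

text \<open>Compactness of \<open>K\<close> supplies cluster points; the family that a failure of
  closedness would produce is excluded by
  \<open>k_space_no_uncountable_locally_finite_family\<close>.\<close>

lemma k_space_closedin_if_countably_closed:
  assumes k: "k_space T" and K: "compactin T K" and "D \<subseteq> K"
    and D: "\<And>C. countable C \<Longrightarrow> C \<subseteq> D \<Longrightarrow> T closure_of C \<subseteq> D"
  shows "closedin T D"
proof (rule ccontr)
  assume "\<not> closedin T D"
  have DC: "D \<subseteq> continuous_functions"
    using \<open>D \<subseteq> K\<close> compactin_subset_topspace[OF K] topspace_T by blast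
  obtain g where g: "g \<in> T closure_of D" "g \<notin> D"
    using \<open>\<not> closedin T D\<close> DC closure_of_subset_eq topspace_T by (metis subsetI)
  have gC: "g \<in> continuous_functions"
    using g(1) unfolding in_closure_of_iff[OF DC] by blast
  \<comment> \<open>One \<open>n\<close> serves all countable \<open>C\<close>: otherwise bad sets
    \<open>C n\<close> would have a countable union, whose closure stays in \<open>D\<close>,
    against \<open>compactin_pointwise_separated\<close>.\<close>
  have "\<exists>n. \<forall>C. countable C \<and> C \<subseteq> D \<longrightarrow> (\<exists>F. finite F \<and> (\<forall>f\<in>C. \<exists>x\<in>F. 1 / real (Suc n) < \<bar>f x - g x\<bar>))"
  proof (rule ccontr)
    assume "\<not> ?thesis"
    then obtain C where C: "\<And>n::nat. countable (C n) \<and> C n \<subseteq> D"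
      "\<And>n F. finite F \<Longrightarrow> \<not> (\<forall>f\<in>C n. \<exists>x\<in>F. 1 / real (Suc n) < \<bar>f x - g x\<bar>)"
      by metis
    have "g \<notin> T closure_of (\<Union>(range C))"
      using D[of "\<Union>(range C)"] C(1) g(2) by blast
    moreover have "\<Union>(range C) \<subseteq> K" using C(1) \<open>D \<subseteq> K\<close> by blast
    ultimately obtain n F where "finite F" "\<And>f. f \<in> \<Union>(range C) \<Longrightarrow> \<exists>x\<in>F. 1 / real (Suc n) < \<bar>f x - g x\<bar>"
      using compactin_pointwise_separated[OF K _ gC] by metis
    then show False using C(2)[of F n] by blast
  qed
  then obtain n where n: "\<forall>C. countable C \<and> C \<subseteq> D \<longrightarrow>
      (\<exists>F. finite F \<and> (\<forall>f\<in>C. \<exists>x\<in>F. 1 / real (Suc n) < \<bar>f x - g x\<bar>))"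
    by (rule exE)
  define e where "e = 1 / real (Suc n)"
  have "e > 0" unfolding e_def by simp
  \<comment> \<open>A cluster point of functions close to \<open>g\<close> on growing finite parts
    of \<open>Y\<close> stays in \<open>D\<close>; passing to it turns the strict bound into
    \<open>\<le>\<close>.\<close>
  have approx: "\<exists>f\<in>D. \<forall>y\<in>Y. \<bar>f y - g y\<bar> \<le> e / 2" if "countable Y" for Y
  proof -
    define y where "y = from_nat_into (insert undefined Y)"
    have y: "Y \<subseteq> range y"
      unfolding y_def using that by (subst range_from_nat_into) auto
    have "\<exists>f\<in>D. \<forall>i\<le>m. \<bar>f (y i) - g (y i)\<bar> < e / 2" for m
    proof -
      define U where "U = (\<Inter>i\<le>m. {f \<in> continuous_functions. f (y i) \<in> ball (g (y i)) (e / 2)})"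
      have "openin T U"
        unfolding U_def by (intro openin_INT2) (auto intro: openin_evaluation simp del: mem_ball)
      moreover have "g \<in> U"
        unfolding U_def using gC \<open>e > 0\<close> by simp
      ultimately obtain f where "f \<in> D" "f \<in> U"
        using g(1) in_closure_of by metis
      then show ?thesis
        unfolding U_def by (intro bexI[of _ f]) (auto simp: dist_real_def abs_minus_commute)
    qed
    then obtain d where d: "\<And>m. d m \<in> D" "\<And>m i. i \<le> m \<Longrightarrow> \<bar>d m (y i) - g (y i)\<bar> < e / 2"
      by metis
    obtain h where h: "h \<in> K" "\<And>U. openin T U \<Longrightarrow> h \<in> U \<Longrightarrow> infinite {m\<in>UNIV. d m \<in> U}"
      using compactin_cluster_point[OF K infinite_UNIV_nat, of d] d(1) \<open>D \<subseteq> K\<close> by blast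
    have hC: "h \<in> continuous_functions"
      using h(1) compactin_subset_topspace[OF K] topspace_T by blast
    have "h \<in> T closure_of (range d)"
      unfolding in_closure_of topspace_T
    proof (intro conjI allI impI hC)
      fix U assume "h \<in> U \<and> openin T U"
      then have "{m\<in>UNIV. d m \<in> U} \<noteq> {}" using h(2) by (metis finite.emptyI)
      then show "\<exists>f. f \<in> range d \<and> f \<in> U" by blast
    qed
    then have "h \<in> D" using D[of "range d"] d(1) by blast
    moreover have "\<bar>h (y i) - g (y i)\<bar> \<le> e / 2" for i
    proof (rule ccontr)
      assume "\<not> ?thesis"
      then have "h \<in> {f \<in> continuous_functions. f (y i) \<in> {t. e / 2 < \<bar>t - g (y i)\<bar>}}"
        using hC by simp
      moreover have "open {t. e / 2 < \<bar>t - g (y i)\<bar>}"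
        by (intro open_Collect_less continuous_intros)
      ultimately have "infinite {m. d m (y i) \<in> {t. e / 2 < \<bar>t - g (y i)\<bar>}}"
        using h(2)[OF openin_evaluation] d(1) DC by (smt (verit) Collect_mono finite_subset mem_Collect_eq)
      then obtain m where "m \<ge> i" "e / 2 < \<bar>d m (y i) - g (y i)\<bar>"
        unfolding infinite_nat_iff_unbounded_le by blast
      then show False using d(2) by force
    qed
    ultimately show ?thesis using y by blast
  qed
  obtain R :: "(nat set \<times> nat set) set" and I
    where R: "wf R" "trans R" "total_on I R" and I: "uncountable I"
      and seg: "\<And>a. countable {b. (b, a) \<in> R}"
    using uncountable_wellorder_countable_segments by blast
  \<comment> \<open>The pair \<open>p\<close> consists of the function and the finite set for stage
    \<open>a\<close>. As the segment below \<open>a\<close> is countable, \<open>n\<close> provides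
    the set and \<open>approx\<close> the function.\<close>
  define P where "P = (\<lambda>(\<phi> :: nat set \<Rightarrow> ('a \<Rightarrow> real) \<times> 'a set) a p. fst p \<in> D \<and> finite (snd p) \<and>
    (\<forall>b. (b, a) \<in> R \<longrightarrow> (\<exists>x\<in>snd p. e < \<bar>fst (\<phi> b) x - g x\<bar>) \<and> (\<forall>x\<in>snd (\<phi> b). \<bar>fst p x - g x\<bar> \<le> e / 2)))"
  have "\<exists>\<phi>. \<forall>a. P \<phi> a (\<phi> a)"
  proof (rule dependent_wf_choice[OF R(1)])
    show "P \<phi> a p = P \<psi> a p" if "\<And>b. (b, a) \<in> R \<Longrightarrow> \<phi> b = \<psi> b" for \<phi> \<psi> a p
      unfolding P_def using that by auto
    fix a \<phi> assume IH: "\<And>b. (b, a) \<in> R \<Longrightarrow> P \<phi> b (\<phi> b)"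
    have "(\<lambda>b. fst (\<phi> b)) ` {b. (b, a) \<in> R} \<subseteq> D"
      using IH unfolding P_def by blast
    from n[rule_format, OF conjI, OF countable_image[OF seg] this, folded e_def]
    obtain F where F: "finite F" "\<And>b. (b, a) \<in> R \<Longrightarrow> \<exists>x\<in>F. e < \<bar>fst (\<phi> b) x - g x\<bar>"
      by blast
    have "countable (\<Union>b\<in>{b. (b, a) \<in> R}. snd (\<phi> b))"
      using seg IH unfolding P_def by (intro countable_UN) (auto intro: countable_finite)
    from approx[OF this] obtain f
      where "f \<in> D" "\<forall>y\<in>(\<Union>b\<in>{b. (b, a) \<in> R}. snd (\<phi> b)). \<bar>f y - g y\<bar> \<le> e / 2" ..
    then have "P \<phi> a (f, F)"
      unfolding P_def using F by auto
    then show "\<exists>p. P \<phi> a p" by blast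
  qed
  then obtain \<phi> where \<phi>: "\<And>a. P \<phi> a (\<phi> a)" by blast
  define f where "f a = fst (\<phi> a)" for a
  define F where "F a = snd (\<phi> a)" for a
  have fD: "f a \<in> D" and finF: "finite (F a)" for a
    using \<phi>[of a] unfolding P_def f_def F_def by blast+
  have far: "\<exists>x\<in>F a. e < \<bar>f b x - g x\<bar>" and close: "\<And>x. x \<in> F b \<Longrightarrow> \<bar>f a x - g x\<bar> \<le> e / 2"
    if "(b, a) \<in> R" for a b
    using \<phi>[of a] that unfolding P_def f_def F_def by blast+
  have "\<exists>\<delta>>0. finite {a\<in>I. F a \<subseteq> enlargement B \<delta>}" if "B \<in> \<BB>" for B
  proof (rule ccontr)
    \<comment> \<open>Otherwise an increasing sequence has \<open>F (a m)\<close> in enlargements of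
      radius \<open>1 / real (Suc m)\<close>. A cluster point \<open>h\<close> of the
      \<open>f (a m)\<close> is close to \<open>g\<close> on every \<open>F (a k)\<close>, yet some
      \<open>f (a m)\<close> is close to \<open>h\<close> near \<open>B\<close> and far from
      \<open>g\<close> at a point of a later \<open>F (a l)\<close>.\<close>
    define S where "S = (\<lambda>m. {a\<in>I. F a \<subseteq> enlargement B (1 / real (Suc m))})"
    assume "\<not> ?thesis"
    then have "infinite (S m)" for m unfolding S_def by simp
    moreover have "S m \<subseteq> S k" if "k \<le> m" for k m
      unfolding S_def using enlargement_mono[OF order_refl, of "1 / real (Suc m)" "1 / real (Suc k)" B] that
      by (auto simp: frac_le)
    ultimately obtain a where a: "\<And>m. a m \<in> S m" "\<And>m. (a m, a (Suc m)) \<in> R"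
      using increasing_choice_from_infinite_sets[OF R(1) R(3), of S]
      by (metis (no_types, lifting) S_def le_add2 mem_Collect_eq plus_1_eq_Suc subsetI)
    have aR: "(a k, a m) \<in> R" if "k < m" for k m
      using that by (induction m) (use a(2) \<open>trans R\<close> in \<open>auto simp: less_Suc_eq dest: transD\<close>)
    obtain h where h: "h \<in> K" "\<And>U. openin T U \<Longrightarrow> h \<in> U \<Longrightarrow> infinite {m\<in>UNIV. f (a m) \<in> U}"
      using compactin_cluster_point[OF K infinite_UNIV_nat, of "\<lambda>m. f (a m)"] fD \<open>D \<subseteq> K\<close> by blast
    have hC: "h \<in> continuous_functions"
      using h(1) compactin_subset_topspace[OF K] topspace_T by blast
    have h_close: "\<bar>h x - g x\<bar> \<le> e / 2" if "x \<in> F (a k)" for k x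
    proof (rule ccontr)
      assume "\<not> ?thesis"
      then have "h \<in> {f \<in> continuous_functions. f x \<in> {t. e / 2 < \<bar>t - g x\<bar>}}"
        using hC by simp
      moreover have "open {t. e / 2 < \<bar>t - g x\<bar>}"
        by (intro open_Collect_less continuous_intros)
      ultimately have "infinite {m. f (a m) x \<in> {t. e / 2 < \<bar>t - g x\<bar>}}"
        using h(2)[OF openin_evaluation] fD DC by (smt (verit) Collect_mono finite_subset mem_Collect_eq)
      then obtain m where "m > k" "e / 2 < \<bar>f (a m) x - g x\<bar>"
        unfolding infinite_nat_iff_unbounded by blast
      then show False using close[OF aR that, of m] by force
    qed
    obtain W where W: "openin T W" "h \<in> W" "W \<subseteq> nbhd h B (e / 2)"
      using openin_subset_nbhd[OF hC \<open>B \<in> \<BB>\<close>] \<open>e > 0\<close> by (metis half_gt_zero)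
    have "{m\<in>UNIV. f (a m) \<in> W} \<noteq> {}"
      using h(2)[OF W(1,2)] by (metis finite.emptyI)
    then obtain m where "f (a m) \<in> nbhd h B (e / 2)"
      using W(3) by blast
    then obtain \<delta> where \<delta>: "\<delta> > 0" "\<And>x. x \<in> enlargement B \<delta> \<Longrightarrow> \<bar>h x - f (a m) x\<bar> < e / 2"
      unfolding nbhd_def by blast
    obtain l0 where l0: "1 / real (Suc l0) < \<delta>"
      using nat_approx_posE[OF \<delta>(1)] by blast
    \<comment> \<open>Being above \<open>m\<close>, the set \<open>F (a l)\<close> detects
      \<open>f (a m)\<close>; being at least \<open>l0\<close>, it lies where \<open>h\<close> and
      \<open>f (a m)\<close> are close.\<close>
    define l where "l = max l0 (Suc m)"
    have "1 / real (Suc l) \<le> 1 / real (Suc l0)" unfolding l_def by (simp add: frac_le)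
    then have "enlargement B (1 / real (Suc l)) \<subseteq> enlargement B \<delta>"
      using l0 by (intro enlargement_mono) auto
    then have "F (a l) \<subseteq> enlargement B \<delta>"
      using a(1)[of l] unfolding S_def by blast
    moreover have "m < l" unfolding l_def by simp
    from far[OF aR[OF this]] obtain x where "x \<in> F (a l)" "e < \<bar>f (a m) x - g x\<bar>"
      by blast
    ultimately show False
      using h_close[of x l] \<delta>(2)[of x] by (smt (verit) field_sum_of_halves subsetD)
  qed
  then show False
    using k_space_no_uncountable_locally_finite_family[OF k I, of F] finF by blast
qed

text \<open>The set \<open>D\<close> of points reached through countable subsets of \<open>A\<close>
  contains the closures of its countable subsets, so its traces on compact sets are closed and so is
  \<open>D\<close>.\<close>

lemma k_space_imp_countable_tightness:
  assumes k: "k_space T" and A: "A \<subseteq> continuous_functions" and g: "g \<in> T closure_of A"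
  obtains C where "countable C" "C \<subseteq> A" "g \<in> T closure_of C"
proof -
  define D where "D = (\<Union>C\<in>{C. countable C \<and> C \<subseteq> A}. T closure_of C)"
  have DT: "D \<subseteq> topspace T"
    unfolding D_def by (auto simp: in_closure_of)
  have D: "T closure_of E \<subseteq> D" if E: "countable E" "E \<subseteq> D" for E
  proof -
    have "\<exists>C. countable C \<and> C \<subseteq> A \<and> h \<in> T closure_of C" if "h \<in> E" for h
      using that E(2) unfolding D_def by blast
    then obtain C where C: "\<And>h. h \<in> E \<Longrightarrow> countable (C h) \<and> C h \<subseteq> A \<and> h \<in> T closure_of (C h)"
      by metis
    have "E \<subseteq> T closure_of (\<Union>(C ` E))"
    proof
      fix h assume "h \<in> E"
      then have "T closure_of (C h) \<subseteq> T closure_of (\<Union>(C ` E))"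
        by (intro closure_of_mono) blast
      then show "h \<in> T closure_of (\<Union>(C ` E))" using C \<open>h \<in> E\<close> by blast
    qed
    then have "T closure_of E \<subseteq> T closure_of (\<Union>(C ` E))"
      by (simp add: closure_of_minimal)
    moreover have "countable (\<Union>(C ` E))" "\<Union>(C ` E) \<subseteq> A"
      using C E(1) by auto
    ultimately show ?thesis unfolding D_def by blast
  qed
  have "closedin (subtopology T K) (K \<inter> D)" if K: "compactin T K" for K
  proof -
    have "T closure_of C \<subseteq> K \<inter> D" if "countable C" "C \<subseteq> K \<inter> D" for C
      using that by (intro Int_greatest D closure_of_minimal compactin_imp_closedin[OF Hausdorff_T K]) auto
    then have "closedin T (K \<inter> D)"
      using k_space_closedin_if_countably_closed[OF k K, of "K \<inter> D"] by blast
    then show ?thesis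
      using closedin_subtopology_Int_closed[of T "K \<inter> D" K] by (simp add: Int_assoc[symmetric])
  qed
  then have "closedin T D"
    using k DT unfolding k_space by blast
  moreover have "A \<subseteq> D"
  proof
    fix f assume "f \<in> A"
    then have "f \<in> T closure_of {f}"
      using A topspace_T closure_of_subset[of "{f}" T] by blast
    then show "f \<in> D" unfolding D_def using \<open>f \<in> A\<close> by (intro UN_I[of "{f}"]) auto
  qed
  ultimately have "g \<in> D"
    using g closure_of_minimal by blast
  then show ?thesis using that unfolding D_def by blast
qed

section \<open>Thinning a strong cover to a gamma sequence\<close>

text \<open>Bumps of all slopes over members of the cover have the zero function in their closure;
  tightness leaves countably many of them, and their sets still serve every
  \<open>B\<close>.\<close>

lemma k_space_imp_countable_subcover:
  assumes k: "k_space T" and \<U>: "open_strong_cover \<BB> \<U>"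
  obtains U :: "nat \<Rightarrow> 'a set" where "\<And>n. U n \<in> \<U>" "\<And>B. B \<in> \<BB> \<Longrightarrow> \<exists>n. strongly_inside B (U n)"
proof -
  have U: "\<And>U. U \<in> \<U> \<Longrightarrow> U \<noteq> UNIV" "\<And>B. B \<in> \<BB> \<Longrightarrow> \<exists>U\<in>\<U>. strongly_inside B U"
    using \<U> unfolding open_strong_cover_iff by auto
  define A where "A = (\<lambda>(U, k). bump U k) ` (\<U> \<times> UNIV)"
  have A: "A \<subseteq> continuous_functions"
    unfolding A_def continuous_functions_def by (auto simp: continuous_bump)
  have "(\<lambda>x. 0) \<in> T closure_of A"
    unfolding in_closure_of_iff[OF A]
  proof (intro conjI ballI allI impI)
    show "(\<lambda>x. 0) \<in> continuous_functions" by (simp add: continuous_functions_def)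
    fix B and \<epsilon> :: real assume "B \<in> \<BB>" "\<epsilon> > 0"
    then obtain V where V: "V \<in> \<U>" "strongly_inside B V" using U(2) by blast
    then obtain k \<delta> where "\<delta> > 0" "\<And>x. x \<in> enlargement B \<delta> \<Longrightarrow> bump V k x = 0"
      using bump_vanishes_near U(1) by metis
    moreover have "bump V k \<in> A" unfolding A_def using V(1) by (intro image_eqI[of _ _ "(V, k)"]) auto
    ultimately show "\<exists>f\<in>A. \<exists>\<delta>>0. \<forall>x\<in>enlargement B \<delta>. \<bar>f x - 0\<bar> < \<epsilon>"
      using \<open>\<epsilon> > 0\<close> by (metis abs_zero diff_self)
  qed
  then obtain C where C: "countable C" "C \<subseteq> A" "(\<lambda>x. 0) \<in> T closure_of C"
    using k_space_imp_countable_tightness[OF k A] by blast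
  from countable_subset_image[THEN iffD1, OF conjI, OF C(1) C(2)[unfolded A_def]]
  obtain P where P: "countable P" "P \<subseteq> \<U> \<times> UNIV" "C = (\<lambda>(U, k). bump U k) ` P"
    by (elim exE conjE)
  have inside: "\<exists>p\<in>P. strongly_inside B (fst p)" if "B \<in> \<BB>" for B
  proof -
    have CC: "C \<subseteq> continuous_functions" using C(2) A by blast
    \<comment> \<open>The bound 1 is the value of a bump outside its set, so a bump smaller than
      that near \<open>B\<close> has \<open>B\<close> strongly inside its set.\<close>
    from C(3)[unfolded in_closure_of_iff[OF CC], THEN conjunct2, rule_format, OF that zero_less_one]
    obtain f \<delta> where f: "f \<in> C" "\<delta> > 0" "\<And>x. x \<in> enlargement B \<delta> \<Longrightarrow> \<bar>f x\<bar> < 1"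
      by auto
    then obtain V k where "(V, k) \<in> P" "f = bump V k" using P(3) by auto
    moreover have "enlargement B \<delta> \<subseteq> V"
      using f(3) bump_outside[of _ V k] calculation(2) by (metis abs_one less_irrefl subsetI)
    ultimately show ?thesis
      using f(2) unfolding strongly_inside_def by force
  qed
  then have "P \<noteq> {}" using singleton_in by blast
  define W where "W n = fst (from_nat_into P n)" for n
  have "W n \<in> \<U>" for n
    unfolding W_def using from_nat_into[OF \<open>P \<noteq> {}\<close>, of n] P(2) by auto
  moreover have "\<exists>n. strongly_inside B (W n)" if "B \<in> \<BB>" for B
    unfolding W_def using inside[OF that] from_nat_into_surj[OF P(1)] by metis
  ultimately show ?thesis using that by blast
qed

text \<open>The functions \<open>\<psi> i\<close> are at least \<open>i + 1\<close> off \<open>V i\<close>, yet each is bounded. If infinitely many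
  lie in a compact set, then a cluster point of those for which \<open>B\<close> is not strongly inside \<open>V i\<close>
  is both bounded and unbounded near \<open>B\<close>.\<close>

lemma k_space_imp_gamma_subsequence:
  assumes k: "k_space T" and \<U>: "open_strong_cover \<BB> \<U>"
  shows "\<exists>U :: nat \<Rightarrow> 'a set. (\<forall>n. U n \<in> \<U>) \<and> (\<forall>B\<in>\<BB>. finite {n. \<not> strongly_inside B (U n)})"
proof -
  obtain U :: "nat \<Rightarrow> 'a set" where U: "\<And>n. U n \<in> \<U>" "\<And>B. B \<in> \<BB> \<Longrightarrow> \<exists>n. strongly_inside B (U n)"
    using k_space_imp_countable_subcover[OF k \<U>] by blast
  have ne: "U n \<noteq> UNIV" for n
    using U(1)[of n] \<U> unfolding open_strong_cover_iff by metis
  \<comment> \<open>An index codes a member and a slope, since the slope needed for a bump to vanish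
    near \<open>B\<close> depends on \<open>B\<close>.\<close>
  define V where "V i = U (fst (prod_decode i))" for i
  \<comment> \<open>Scaling preserves exact zeros, so the zero function stays in the
    closure.\<close>
  define \<psi> where "\<psi> i = (\<lambda>x. real (Suc i) * bump (V i) (snd (prod_decode i)) x)" for i
  have \<psi>C: "range \<psi> \<subseteq> continuous_functions"
    unfolding \<psi>_def continuous_functions_def by (auto intro!: continuous_intros continuous_bump)
  have \<psi>_out: "\<psi> i x = real (Suc i)" if "x \<notin> V i" for i x
    unfolding \<psi>_def bump_outside[OF that] by simp
  have \<psi>_le: "\<psi> i x \<le> real (Suc i)" for i x
    unfolding \<psi>_def using bump_le_1 by (intro mult_left_le) auto
  have "(\<lambda>x. 0) \<in> T closure_of (range \<psi>)"
    unfolding in_closure_of_iff[OF \<psi>C]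
  proof (intro conjI ballI allI impI)
    show "(\<lambda>x. 0) \<in> continuous_functions" by (simp add: continuous_functions_def)
    fix B and \<epsilon> :: real assume "B \<in> \<BB>" "\<epsilon> > 0"
    then obtain n where "strongly_inside B (U n)" using U(2) by blast
    then obtain k \<delta> where *: "\<delta> > 0" "\<And>x. x \<in> enlargement B \<delta> \<Longrightarrow> bump (U n) k x = 0"
      using bump_vanishes_near ne by metis
    then have "\<psi> (prod_encode (n, k)) x = 0" if "x \<in> enlargement B \<delta>" for x
      unfolding \<psi>_def V_def using that by simp
    then show "\<exists>f\<in>range \<psi>. \<exists>\<delta>>0. \<forall>x\<in>enlargement B \<delta>. \<bar>f x - 0\<bar> < \<epsilon>"
      using *(1) \<open>\<epsilon> > 0\<close> by (intro bexI[of _ "\<psi> (prod_encode (n, k))"] exI[of _ \<delta>]) auto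
  qed
  moreover have "(\<lambda>x. 0) \<notin> range \<psi>"
  proof
    assume "(\<lambda>x. 0) \<in> range \<psi>"
    then obtain i where i: "\<And>x. \<psi> i x = 0" by (metis imageE)
    obtain x where "x \<notin> V i" unfolding V_def using ne by blast
    then show False using \<psi>_out i by (metis of_nat_0_eq_iff nat.distinct(1))
  qed
  ultimately have "\<not> closedin T (range \<psi>)"
    using closure_of_eq by metis
  then obtain K where K: "compactin T K" "\<not> closedin (subtopology T K) (K \<inter> range \<psi>)"
    using k \<psi>C unfolding k_space topspace_T by blast
  define I where "I = {i. \<psi> i \<in> K}"
  \<comment> \<open>Finite sets are closed in a Hausdorff space, whereas the trace on
    \<open>K\<close> is not.\<close>
  have "infinite I"
  proof
    assume "finite I"
    moreover have "K \<inter> range \<psi> = \<psi> ` I" unfolding I_def by blast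
    ultimately have "closedin T (K \<inter> range \<psi>)"
      using closedin_Hausdorff_finite[OF Hausdorff_T] \<psi>C topspace_T by (metis finite_imageI inf.coboundedI2)
    then show False
      using K(2) closedin_subtopology_Int_closed[of T "K \<inter> range \<psi>" K] by (simp add: Int_assoc[symmetric])
  qed
  have fin: "finite {i\<in>I. \<not> strongly_inside B (V i)}" if B: "B \<in> \<BB>" for B
  proof (rule ccontr)
    define J where "J = {i\<in>I. \<not> strongly_inside B (V i)}"
    assume "\<not> ?thesis"
    then have "infinite J" "\<psi> ` J \<subseteq> K" unfolding J_def I_def by auto
    then obtain h where h: "h \<in> K" "\<And>W. openin T W \<Longrightarrow> h \<in> W \<Longrightarrow> infinite {i\<in>J. \<psi> i \<in> W}"
      using compactin_cluster_point[OF K(1)] by metis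
    have hC: "h \<in> continuous_functions"
      using h(1) compactin_subset_topspace[OF K(1)] topspace_T by blast
    obtain W where W: "openin T W" "h \<in> W" "W \<subseteq> nbhd h B 1"
      using openin_subset_nbhd[OF hC B zero_less_one] by blast
    then have inf: "infinite {i\<in>J. \<psi> i \<in> W}" using h(2) by blast
    obtain i where i: "i \<in> J" "\<psi> i \<in> W"
      using inf unfolding infinite_nat_iff_unbounded by blast
    \<comment> \<open>At a point near \<open>B\<close> outside \<open>V j\<close>, closeness within
      1 will give both \<open>h x < i + 2\<close> and \<open>h x > j\<close>.\<close>
    obtain j where j: "j \<in> J" "\<psi> j \<in> W" "i + 2 < j"
      using inf unfolding infinite_nat_iff_unbounded by blast
    obtain \<delta> where \<delta>: "\<delta> > 0" "\<And>x. x \<in> enlargement B \<delta> \<Longrightarrow> \<bar>h x - \<psi> i x\<bar> < 1"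
      using i(2) W(3) unfolding nbhd_def by blast
    obtain \<eta> where \<eta>: "\<eta> > 0" "\<And>x. x \<in> enlargement B \<eta> \<Longrightarrow> \<bar>h x - \<psi> j x\<bar> < 1"
      using j(2) W(3) unfolding nbhd_def by blast
    have "\<not> enlargement B (min \<delta> \<eta>) \<subseteq> V j"
      using j(1) \<delta>(1) \<eta>(1) unfolding J_def strongly_inside_def by simp
    then obtain x where "x \<in> enlargement B (min \<delta> \<eta>)" and x: "x \<notin> V j"
      by blast
    then have x_near: "x \<in> enlargement B \<delta>" "x \<in> enlargement B \<eta>"
      by (auto simp: enlargement_iff)
    have "h x < real (Suc i) + 1"
      using \<delta>(2)[OF x_near(1)] \<psi>_le[of i x] by linarith
    moreover have "real (Suc j) - 1 < h x"
      using \<eta>(2)[OF x_near(2)] \<psi>_out[OF x] by linarith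
    ultimately show False using j(3) by simp
  qed
  \<comment> \<open>Injectivity carries finiteness from exceptional elements of \<open>I\<close>
    back to their positions.\<close>
  have r: "inj (enumerate I)" "\<And>n. enumerate I n \<in> I"
    using \<open>infinite I\<close> strict_mono_enumerate strict_mono_imp_inj_on enumerate_in_set by blast+
  have "finite {n. \<not> strongly_inside B (V (enumerate I n))}" if "B \<in> \<BB>" for B
    using finite_vimageI[OF fin[OF that] r(1)] r(2) by (simp add: vimage_def)
  then show ?thesis
    using U(1) unfolding V_def by (intro exI[of _ "\<lambda>n. U (fst (prod_decode (enumerate I n)))"]) simp
qed

end

theorem theorem4p1:
  fixes \<BB> :: "'a::metric_space set set"
  assumes "infinite (UNIV :: 'a set)"
    and "bornology \<BB>"
    and "has_closed_base \<BB>"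
    and "UNIV \<notin> \<BB>"
  shows "(k_space (strong_uniform_topology \<BB>) \<longleftrightarrow>
            frechet_urysohn_space (strong_uniform_topology \<BB>)) \<and>
         (frechet_urysohn_space (strong_uniform_topology \<BB>) \<longleftrightarrow>
            selection_S1 {\<U>. open_strong_cover \<BB> \<U>} {\<U>. strong_gamma_cover \<BB> \<U>})"
proof -
  interpret strong_bornology \<BB>
    using assms by unfold_locales
  \<comment> \<open>The cycle runs from k-space to selection to Frechet-Urysohn and back to
    k-space.\<close>
  show ?thesis
    using frechet_urysohn_imp_k_space frechet_urysohn_if_selection
      selection_if_gamma_subsequences[OF k_space_imp_gamma_subsequence] by blast
qed

end
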